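(* Let $(\lambda,x)$ be an eigenpair of a Hermitian matrix $A\in\mathbb{C}^{n\times n}$ and let $T$ be a Hermitian positive definite matrix (preconditioner) such that $TA=AT$. Let $(\theta,v)$ be a $T$-harmonic Ritz pair of $A$ with respect to a subspace $\mathcal{K}\subseteq\mathbb{C}^n$ and a (real) shift $\sigma\notin\Lambda(A)$. Let $\Theta$ be the set of all the $T$-harmonic Ritz values and let $P_{\mathcal{Q}}$ be the orthogonal projector onto $\mathcal{Q}=T^{1/2}(A-\sigma I)\mathcal{K}$. Then $$\sin\angle(x,v)\le \kappa(T^{1/2}(A-\sigma I))\sqrt{1+\frac{\gamma^2}{\delta^2}}\;\sin\angle(x,\mathcal{K}),$$ where $\gamma=\|P_{\mathcal{Q}}(A-\sigma I)^{-1}(I-P_{\mathcal{Q}})\|$, $$\delta=\min_{\theta_j\in\Theta\setminus\theta}\left|\frac{\theta_j-\lambda}{(\lambda-\sigma)(\theta_j-\sigma)}\right|,$$ and $\kappa(T^{1/2}(A-\sigma I))=|\nu_{\max}/\nu_{\min}|$, where $\nu_{\min}$ and $\nu_{\max}$ are the smallest and largest magnitude eigenvalues of $T^{1/2}(A-\sigma I)$, respectively.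
   Context: $\Lambda(A)$ is the spectrum of $A$. For nonzero vectors, $\angle(x,y)\in[0,\pi/2]$ is defined by $\cos\angle(x,y)=|x^*y|/(\|x\|\|y\|)$, and $\angle(x,\mathcal{K})=\min_{y\in\mathcal{K},\,y\ne0}\angle(x,y)$. The matrix norm $\|\cdot\|$ is either the spectral or the Frobenius norm. $T^{1/2}$ is the Hermitian positive definite square root of $T$. $T$-harmonic Ritz pairs of $A$ with respect to $\mathcal{K}$ and $\sigma$ are the pairs $(\theta,v)$ with $v\in\mathcal{K}$, $v\neq0$, such that $Av-\theta v$ is orthogonal to $(A-\sigma I)\mathcal{K}$ in the inner product $(\cdot,\cdot)_T=(\cdot,T\,\cdot)$. Equivalently, if $K$ is a matrix whose columns form a basis of $\mathcal{K}$, the eigenpairs $(\xi,c)$ of $K^*(A-\sigma I)T(A-\sigma I)Kc=\xi\,K^*(A-\sigma I)TKc$ yield the $T$-harmonic Ritz value $\theta=\xi+\sigma$ and the $T$-harmonic Ritz vector $v=Kc$. In the set $\Theta$, multiple $T$-harmonic Ritz values are repeated; $\Theta\setminus\theta$ is $\Theta$ with the value $\theta$ of the pair $(\theta,v)$ removed.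
   Formalization: If K*(A−σI)TK is singular, Θ also contains the infinite harmonic Ritz value, contributing 1/|λ−σ| to δ (the claim fails without it); δ≠0 is assumed so that γ²/δ² is defined, and the minimum over an empty set is ∞. *)

theory Defs
  imports "HOL-Analysis.Analysis" "HOL-Library.Multiset" "HOL-Library.Extended_Real"
begin

text \<open>
  Complex column vectors and square matrices are \<open>complex ^ 'n\<close> and \<open>complex ^ 'n ^ 'n\<close>.
  The class-based constants \<open>subspace\<close> and \<open>inner\<close> refer to the underlying real space, so the
  complex-linear notions \<open>vec.subspace\<close>, \<open>vec.dim\<close> and the sesquilinear product below are
  used instead; \<open>norm\<close> on \<open>complex ^ 'n\<close> is the Euclidean norm.
\<close>

definition cdot :: "complex ^ 'n \<Rightarrow> complex ^ 'n \<Rightarrow> complex"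
  where "cdot x y = (\<Sum>i\<in>UNIV. cnj (x $ i) * y $ i)"

definition hermitian :: "complex ^ 'n ^ 'n \<Rightarrow> bool"
  where "hermitian A \<longleftrightarrow> (\<chi> i j. cnj (A $ j $ i)) = A"

text \<open>For Hermitian \<open>A\<close> the value \<open>cdot x (A *v x)\<close> is real.\<close>

definition hpd :: "complex ^ 'n ^ 'n \<Rightarrow> bool"
  where "hpd A \<longleftrightarrow> hermitian A \<and> (\<forall>x. x \<noteq> 0 \<longrightarrow> 0 < Re (cdot x (A *v x)))"

definition hpd_sqrt :: "complex ^ 'n ^ 'n \<Rightarrow> complex ^ 'n ^ 'n"
  where "hpd_sqrt T = (THE S. hpd S \<and> S ** S = T)"

definition eigenpair :: "complex ^ 'n ^ 'n \<Rightarrow> complex \<Rightarrow> complex ^ 'n \<Rightarrow> bool"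
  where "eigenpair A lam x \<longleftrightarrow> x \<noteq> 0 \<and> A *v x = lam *s x"

definition spectrum :: "complex ^ 'n ^ 'n \<Rightarrow> complex set"
  where "spectrum A = {lam. \<exists>x. eigenpair A lam x}"

abbreviation shifted :: "complex ^ 'n ^ 'n \<Rightarrow> real \<Rightarrow> complex ^ 'n ^ 'n"
  where "shifted A \<sigma> \<equiv> A - mat (complex_of_real \<sigma>)"

definition spectral_norm :: "complex ^ 'n ^ 'n \<Rightarrow> real"
  where "spectral_norm A = onorm ((*v) A)"

definition frobenius_norm :: "complex ^ 'n ^ 'n \<Rightarrow> real"
  where "frobenius_norm A = sqrt (\<Sum>i\<in>UNIV. \<Sum>j\<in>UNIV. (cmod (A $ i $ j))\<^sup>2)"

text \<open>\<open>arg_max\<close> and \<open>arg_min\<close> choose an eigenvalue of largest and of smallest modulus.\<close>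

definition cond_number :: "complex ^ 'n ^ 'n \<Rightarrow> real"
  where "cond_number A =
    (let \<nu>max = arg_max cmod (\<lambda>\<nu>. \<nu> \<in> spectrum A);
         \<nu>min = arg_min cmod (\<lambda>\<nu>. \<nu> \<in> spectrum A)
     in cmod (\<nu>max / \<nu>min))"

definition orth_projector :: "(complex ^ 'n) set \<Rightarrow> complex ^ 'n ^ 'n"
  where "orth_projector Q = (THE P. hermitian P \<and> P ** P = P \<and> range ((*v) P) = Q)"

definition angle :: "complex ^ 'n \<Rightarrow> complex ^ 'n \<Rightarrow> real"
  where "angle x y = arccos (cmod (cdot x y) / (norm x * norm y))"

text \<open>For a subspace \<open>K \<noteq> {0}\<close> the infimum is a minimum (by compactness of the unit sphere).\<close>

definition angle_subspace :: "complex ^ 'n \<Rightarrow> (complex ^ 'n) set \<Rightarrow> real"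
  where "angle_subspace x K = (INF y \<in> K - {0}. angle x y)"

definition harmonic_ritz_pair ::
  "complex ^ 'n ^ 'n \<Rightarrow> complex ^ 'n ^ 'n \<Rightarrow> (complex ^ 'n) set \<Rightarrow> real \<Rightarrow> complex \<Rightarrow> complex ^ 'n \<Rightarrow> bool"
  where "harmonic_ritz_pair T A K \<sigma> \<theta> v \<longleftrightarrow>
    v \<in> K \<and> v \<noteq> 0 \<and>
    (\<forall>u\<in>K. cdot (A *v v - \<theta> *s v) (T *v (shifted A \<sigma> *v u)) = 0)"

text \<open>
  If the columns of \<open>K\<close> are a basis of the subspace, the harmonic Ritz values are the numbers
  \<open>\<xi> + \<sigma>\<close> for the eigenvalues \<open>\<xi>\<close> of the pencil \<open>M c = \<xi> N c\<close> with
  \<open>M = K\<^sup>* (A - \<sigma>I) T (A - \<sigma>I) K\<close> and \<open>N = K\<^sup>* (A - \<sigma>I) T K\<close>. Here \<open>M\<close> is positive definite, but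
  \<open>N\<close> may be singular, and then the pencil also has the eigenvalue \<open>\<infinity>\<close>, with eigenvectors \<open>c\<close>
  such that \<open>N c = 0\<close>. The multiset of harmonic Ritz values has to contain it: otherwise
  \<open>T = A\<^sup>-\<^sup>2\<close>, \<open>\<sigma> = 0\<close>, \<open>A = diag(1,-1,2)\<close>, \<open>K = span {e\<^sub>1 + e\<^sub>2, e\<^sub>3}\<close>, \<open>v = e\<^sub>3\<close>, \<open>x = e\<^sub>1\<close>
  contradicts the error bound.

  Since \<open>N\<close> is Hermitian and \<open>M\<close> positive definite, algebraic and geometric multiplicities
  of the eigenvalues of the pencil agree; a value is repeated as often as the dimension of its
  space of vectors says. For fixed \<open>\<theta>\<close> this space is the set of the \<open>v\<close> in harmonic Ritz pairs
  \<open>(\<theta>, v)\<close>, together with \<open>0\<close>.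
\<close>

datatype ritz_value = Finite_Ritz complex | Infinite_Ritz

fun harmonic_ritz_space ::
  "complex ^ 'n ^ 'n \<Rightarrow> complex ^ 'n ^ 'n \<Rightarrow> (complex ^ 'n) set \<Rightarrow> real \<Rightarrow> ritz_value \<Rightarrow> (complex ^ 'n) set"
  where
    "harmonic_ritz_space T A K \<sigma> (Finite_Ritz \<theta>) = insert 0 {v. harmonic_ritz_pair T A K \<sigma> \<theta> v}"
  | "harmonic_ritz_space T A K \<sigma> Infinite_Ritz =
       {v \<in> K. \<forall>u\<in>K. cdot v (T *v (shifted A \<sigma> *v u)) = 0}"

definition harmonic_ritz_values ::
  "complex ^ 'n ^ 'n \<Rightarrow> complex ^ 'n ^ 'n \<Rightarrow> (complex ^ 'n) set \<Rightarrow> real \<Rightarrow> ritz_value multiset"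
  where "harmonic_ritz_values T A K \<sigma> = Abs_multiset (\<lambda>t. vec.dim (harmonic_ritz_space T A K \<sigma> t))"

text \<open>The second equation is the limit of the first one for \<open>\<theta> \<rightarrow> \<infinity>\<close>.\<close>

fun ritz_gap :: "complex \<Rightarrow> real \<Rightarrow> ritz_value \<Rightarrow> real"
  where
    "ritz_gap lam \<sigma> (Finite_Ritz \<theta>) =
       cmod ((\<theta> - lam) / ((lam - complex_of_real \<sigma>) * (\<theta> - complex_of_real \<sigma>)))"
  | "ritz_gap lam \<sigma> Infinite_Ritz = cmod (1 / (lam - complex_of_real \<sigma>))"

text \<open>
  The minimum of the gaps over a finite multiset, with the usual convention \<open>min \<emptyset> = \<infinity>\<close>;
  the empty case occurs for one-dimensional \<open>K\<close>.
\<close>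

definition min_gap :: "complex \<Rightarrow> real \<Rightarrow> ritz_value multiset \<Rightarrow> ereal"
  where "min_gap lam \<sigma> \<Theta> = (INF t \<in> set_mset \<Theta>. ereal (ritz_gap lam \<sigma> t))"

end

theory Submission
  imports Defs
begin

text \<open>
  Put \<open>S = A - \<sigma>I\<close>, \<open>B = T\<^sup>1\<^sup>/\<^sup>2 S\<close> and \<open>Q = B K\<close>. Since \<open>T\<^sup>1\<^sup>/\<^sup>2\<close> commutes with \<open>A\<close>, the vector \<open>y = B x\<close>
  is an eigenvector of \<open>S\<inverse>\<close> for \<open>\<eta> = 1 / (\<lambda> - \<sigma>)\<close>, and harmonic Ritz pairs \<open>(\<theta>, v)\<close> correspond to
  ordinary Rayleigh-Ritz pairs \<open>(1 / (\<theta> - \<sigma>), B v)\<close> of \<open>S\<inverse>\<close> with respect to \<open>Q\<close>, the gaps becoming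
  differences of Ritz values from \<open>\<eta>\<close>. Split \<open>P y = a w + z\<close> with \<open>w = B v\<close> and \<open>z\<close> orthogonal
  to \<open>w\<close>. Applying \<open>P (S\<inverse> - \<eta>)\<close> to \<open>y = P y + (y - P y)\<close> gives
  \<open>\<delta> \<parallel>z\<parallel> \<le> \<parallel>P (S\<inverse> - \<eta>) z\<parallel> \<le> \<gamma> \<parallel>y - P y\<parallel>\<close>, so that
  \<open>\<parallel>y - a w\<parallel>\<^sup>2 \<le> (1 + \<gamma>\<^sup>2/\<delta>\<^sup>2) \<parallel>y - P y\<parallel>\<^sup>2\<close>. The left side is at least \<open>|\<nu>\<^sub>m\<^sub>i\<^sub>n|\<^sup>2 \<parallel>x - a v\<parallel>\<^sup>2\<close>, and
  \<open>\<parallel>y - P y\<parallel> \<le> \<parallel>B (x - k)\<parallel> \<le> |\<nu>\<^sub>m\<^sub>a\<^sub>x| \<parallel>x - k\<parallel>\<close> for every \<open>k\<close> in \<open>K\<close>.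
\<close>

section \<open>The sesquilinear product and the Euclidean norm\<close>

lemma cdot_add_right: "cdot x (y + z) = cdot x y + cdot x z"
  by (simp add: cdot_def distrib_left sum.distrib)

lemma cdot_add_left: "cdot (x + y) z = cdot x z + cdot y z"
  by (simp add: cdot_def distrib_right sum.distrib)

lemma cdot_diff_right: "cdot x (y - z) = cdot x y - cdot x z"
  by (simp add: cdot_def right_diff_distrib sum_subtractf)

lemma cdot_diff_left: "cdot (x - y) z = cdot x z - cdot y z"
  by (simp add: cdot_def left_diff_distrib sum_subtractf)

lemma cdot_scale_right: "cdot x (c *s y) = c * cdot x y"
  by (simp add: cdot_def sum_distrib_left mult_ac)

lemma cdot_scale_left: "cdot (c *s x) y = cnj c * cdot x y"
  by (simp add: cdot_def sum_distrib_left mult_ac)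

lemma cdot_0_left [simp]: "cdot 0 y = 0" and cdot_0_right [simp]: "cdot x 0 = 0"
  by (simp_all add: cdot_def)

lemmas cdot_simps = cdot_add_right cdot_add_left cdot_diff_right cdot_diff_left
  cdot_scale_right cdot_scale_left

lemma cdot_sum_right: "cdot x (sum f E) = (\<Sum>e\<in>E. cdot x (f e))"
  by (induction E rule: infinite_finite_induct) (simp_all add: cdot_add_right)

lemma cnj_cdot: "cnj (cdot x y) = cdot y x"
  by (simp add: cdot_def mult_ac)

lemma cdot_eq_0_sym: "cdot x y = 0 \<longleftrightarrow> cdot y x = 0"
  using cnj_cdot[of x y] cnj_cdot[of y x] by auto

lemma cdot_self: "cdot x x = of_real ((norm x)\<^sup>2)"
proof -
  have "(norm x)\<^sup>2 = (\<Sum>i\<in>UNIV. (cmod (x $ i))\<^sup>2)"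
    by (simp add: norm_vec_def L2_set_def sum_nonneg)
  then show ?thesis
    by (simp add: cdot_def complex_norm_square[symmetric] mult.commute[of "cnj _"])
qed

lemma cdot_self_eq_0 [simp]: "cdot x x = 0 \<longleftrightarrow> x = 0"
  by (simp add: cdot_self)

lemma norm_vec_scale: "norm (c *s x) = cmod c * norm (x :: complex ^ 'n)"
proof -
  have "complex_of_real ((norm (c *s x))\<^sup>2) = of_real ((cmod c * norm x)\<^sup>2)"
    unfolding cdot_self[symmetric] power_mult_distrib of_real_mult complex_norm_square
    by (simp only: cdot_scale_left cdot_scale_right mult_ac)
  then show ?thesis
    unfolding of_real_eq_iff by (rule power2_eq_imp_eq) simp_all
qed

lemma norm_add_orthogonal:
  assumes "cdot x y = 0"
  shows "(norm (x + y))\<^sup>2 = (norm x)\<^sup>2 + (norm y)\<^sup>2"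
proof -
  have "complex_of_real ((norm (x + y))\<^sup>2) = of_real ((norm x)\<^sup>2 + (norm y)\<^sup>2)"
    unfolding cdot_self[symmetric] of_real_add
    using assms cdot_eq_0_sym[of x y] by (simp add: cdot_simps)
  then show ?thesis using of_real_eq_iff by blast
qed

lemma scaleR_vec_eq_scale: "r *\<^sub>R x = complex_of_real r *s (x :: complex ^ 'n)"
  unfolding vec_eq_iff vector_scaleR_component vector_smult_component
  by (simp add: scaleR_conv_of_real)

text \<open>Prepares the first variation of norms along a real parameter \<open>t\<close>.\<close>

lemma norm_add_real_scale:
  "(norm (x + complex_of_real t *s y))\<^sup>2 =
    (norm x)\<^sup>2 + 2 * t * Re (cdot x y) + t\<^sup>2 * (norm y)\<^sup>2"
proof -
  have e: "(norm z)\<^sup>2 = Re (cdot z z)" for z :: "complex ^ 'a"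
    by (simp add: cdot_self)
  have "Re (cdot y x) = Re (cdot x y)"
    by (metis cnj_cdot complex_cnj(1) complex.sel(1) complex_surj)
  then show ?thesis
    by (simp only: e cdot_simps) (simp add: algebra_simps power2_eq_square)
qed

text \<open>Pythagoras for the orthogonal projection of \<open>x\<close> onto the line of
  \<open>y\<close>. It yields both Cauchy-Schwarz and the geometric meaning of the sine.\<close>

lemma norm_cdot_residual:
  assumes "y \<noteq> 0"
  shows "(norm (x - (cdot y x / of_real ((norm y)\<^sup>2)) *s y))\<^sup>2
    = (norm x)\<^sup>2 - (cmod (cdot x y))\<^sup>2 / (norm y)\<^sup>2"
proof -
  define a where "a = cdot y x / of_real ((norm y)\<^sup>2)"
  have "cdot y (x - a *s y) = 0"
    using assms by (simp add: a_def cdot_simps cdot_self)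
  then have "cdot (a *s y) (x - a *s y) = 0"
    by (simp add: cdot_scale_left)
  then have "(norm (a *s y + (x - a *s y)))\<^sup>2 = (norm (a *s y))\<^sup>2 + (norm (x - a *s y))\<^sup>2"
    by (rule norm_add_orthogonal)
  moreover have "(norm (a *s y))\<^sup>2 = (cmod (cdot x y))\<^sup>2 / (norm y)\<^sup>2"
    using assms cnj_cdot[of x y] complex_mod_cnj[of "cdot x y"]
    by (simp add: norm_vec_scale a_def norm_divide norm_power power2_eq_square norm_mult)
  ultimately show ?thesis by (simp add: a_def)
qed

lemma cmod_cdot_le: "cmod (cdot x y) \<le> norm x * norm y"
proof (cases "y = 0")
  case False
  have "0 \<le> (norm x)\<^sup>2 - (cmod (cdot x y))\<^sup>2 / (norm y)\<^sup>2"
    unfolding norm_cdot_residual[OF False, symmetric] by (rule zero_le_power2)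
  then have "(cmod (cdot x y))\<^sup>2 \<le> (norm x * norm y)\<^sup>2"
    using False by (simp add: divide_le_eq power_mult_distrib)
  then show ?thesis by (rule power2_le_imp_le) simp
qed simp

section \<open>Angles between vectors and subspaces\<close>

lemma angle_bounds: "0 \<le> angle x y" "angle x y \<le> pi / 2"
proof -
  have "0 \<le> cmod (cdot x y) / (norm x * norm y)" "cmod (cdot x y) / (norm x * norm y) \<le> 1"
    using cmod_cdot_le[of x y] by (auto simp: divide_le_eq_1 less_le)
  then show "0 \<le> angle x y" "angle x y \<le> pi / 2"
    unfolding angle_def by (auto intro: arccos_lbound[OF order_trans[of _ 0]]
        intro!: arccos_le_pi2[simplified] simp del: zero_le_divide_iff)
qed

text \<open>With \<open>angle\<close> defined by \<open>arccos\<close>, the sine is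
  \<open>sqrt (1 - c\<^sup>2)\<close>, so the left side is the distance from \<open>x\<close> to the
  line of \<open>y\<close>.\<close>

lemma norm_mult_sin_angle:
  assumes "x \<noteq> 0" "y \<noteq> 0"
  shows "norm x * sin (angle x y) = norm (x - (cdot y x / of_real ((norm y)\<^sup>2)) *s y)"
proof -
  define c where "c = cmod (cdot x y) / (norm x * norm y)"
  have c: "0 \<le> c" "c \<le> 1"
    unfolding c_def using cmod_cdot_le[of x y] by (auto simp: divide_le_eq_1 less_le)
  then have "sin (angle x y) = sqrt (1 - c\<^sup>2)"
    unfolding angle_def c_def[symmetric] by (intro sin_arccos) auto
  then have "(norm x * sin (angle x y))\<^sup>2 = (norm x)\<^sup>2 * (1 - c\<^sup>2)"
    using c by (simp add: power_mult_distrib power_le_one)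
  also have "\<dots> = (norm x)\<^sup>2 - (cmod (cdot x y))\<^sup>2 / (norm y)\<^sup>2"
    using assms by (simp add: c_def power_divide power_mult_distrib field_simps)
  also have "\<dots> = (norm (x - (cdot y x / of_real ((norm y)\<^sup>2)) *s y))\<^sup>2"
    using norm_cdot_residual[OF assms(2)] by simp
  finally have eq: "(norm x * sin (angle x y))\<^sup>2 = (norm (x - (cdot y x / of_real ((norm y)\<^sup>2)) *s y))\<^sup>2" .
  have "0 \<le> sin (angle x y)"
    using angle_bounds[of x y] pi_gt_zero by (intro sin_ge_zero) linarith+
  then show ?thesis
    by (intro power2_eq_imp_eq[OF eq]) simp_all
qed

text \<open>The foot of the perpendicular is the point of the line nearest to
  \<open>x\<close>.\<close>

lemma norm_mult_sin_angle_le: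
  assumes "x \<noteq> 0" "y \<noteq> 0"
  shows "norm x * sin (angle x y) \<le> norm (x - a *s y)"
proof -
  define b where "b = cdot y x / of_real ((norm y)\<^sup>2)"
  have "cdot y (x - b *s y) = 0"
    using assms by (simp add: b_def cdot_simps cdot_self)
  then have "cdot (x - b *s y) ((b - a) *s y) = 0"
    by (metis cdot_eq_0_sym cdot_scale_right mult_zero_right)
  from norm_add_orthogonal[OF this]
  have "(norm (x - b *s y))\<^sup>2 \<le> (norm (x - a *s y))\<^sup>2"
    by (simp add: vec.scale_left_diff_distrib)
  then show ?thesis
    unfolding norm_mult_sin_angle[OF assms] b_def[symmetric] by (rule power2_le_imp_le) simp
qed

text \<open>The infimum is bounded below through \<open>arcsin\<close>, so its attainment is not needed.\<close>

lemma le_sin_angle_subspace: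
  assumes "y0 \<in> K" "y0 \<noteq> 0" "0 \<le> L"
    and L: "\<And>y. y \<in> K \<Longrightarrow> y \<noteq> 0 \<Longrightarrow> L \<le> sin (angle x y)"
  shows "L \<le> sin (angle_subspace x K)"
proof -
  have L1: "L \<le> 1" using L[OF assms(1,2)] sin_le_one[of "angle x y0"] by linarith
  have "arcsin L \<le> angle x y" if "y \<in> K - {0}" for y
  proof -
    have "L \<le> sin (angle x y)" using L that by auto
    then have "arcsin L \<le> arcsin (sin (angle x y))"
      using \<open>0 \<le> L\<close> by (intro arcsin_le_arcsin) auto
    also have "\<dots> = angle x y"
      using angle_bounds[of x y] pi_gt_zero by (intro arcsin_sin) linarith+
    finally show ?thesis .
  qed
  then have lower: "arcsin L \<le> angle_subspace x K"
    unfolding angle_subspace_def using assms by (intro cINF_greatest) auto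
  have "angle_subspace x K \<le> angle x y0"
    unfolding angle_subspace_def using assms
    by (intro cINF_lower bdd_belowI2[of _ 0]) (auto simp: angle_bounds)
  then have "angle_subspace x K \<le> pi / 2" using angle_bounds[of x y0] by linarith
  moreover have "- (pi / 2) \<le> arcsin L" using \<open>0 \<le> L\<close> L1 arcsin_lbound[of L] by auto
  ultimately have "sin (arcsin L) \<le> sin (angle_subspace x K)"
    using lower by (intro sin_monotone_2pi_le) auto
  then show ?thesis using \<open>0 \<le> L\<close> L1 by simp
qed

section \<open>Hermitian matrices and shifts\<close>

lemma hermitian_cdot:
  assumes "hermitian A"
  shows "cdot (A *v x) y = cdot x (A *v y)"
proof -
  have A: "cnj (A $ i $ j) = A $ j $ i" for i j
    using assms unfolding hermitian_def by (metis vec_lambda_beta)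
  have "cdot (A *v x) y = (\<Sum>i\<in>UNIV. \<Sum>j\<in>UNIV. cnj (A $ i $ j) * cnj (x $ j) * y $ i)"
    by (simp add: cdot_def matrix_vector_mult_def sum_distrib_right)
  also have "\<dots> = (\<Sum>j\<in>UNIV. \<Sum>i\<in>UNIV. cnj (x $ j) * (A $ j $ i * y $ i))"
    by (subst sum.swap) (simp add: A mult_ac)
  also have "\<dots> = cdot x (A *v y)"
    by (simp add: cdot_def matrix_vector_mult_def sum_distrib_left)
  finally show ?thesis .
qed

lemma cdot_axis_left: "cdot (axis i 1) y = y $ i"
proof -
  have "cdot (axis i 1) y = (\<Sum>k\<in>UNIV. if k = i then y $ k else 0)"
    unfolding cdot_def by (intro sum.cong) (auto simp: axis_def)
  then show ?thesis by simp
qed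

lemma matrix_axis_nth: "(A *v axis j 1) $ i = (A :: complex ^ 'n ^ 'n) $ i $ j"
  by (simp add: matrix_vector_mult_def axis_def if_distrib[of "\<lambda>a. _ * a"] cong: if_cong)

lemma hermitianI:
  fixes A :: "complex ^ 'n ^ 'n"
  assumes "\<And>x y. cdot (A *v x) y = cdot x (A *v y)"
  shows "hermitian A"
proof -
  have "cnj (A $ j $ i) = A $ i $ j" for i j
  proof -
    have "cnj (A $ j $ i) = cnj (cdot (axis j 1) (A *v axis i 1))"
      by (simp add: cdot_axis_left matrix_axis_nth)
    also have "\<dots> = cdot (axis i 1) (A *v axis j 1)"
      by (simp add: cnj_cdot assms)
    finally show ?thesis by (simp add: cdot_axis_left matrix_axis_nth)
  qed
  then show ?thesis by (simp add: hermitian_def vec_eq_iff)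
qed

lemma mat_vec_eq_scale: "mat c *v x = c *s (x :: complex ^ 'n)"
  by (simp add: vec_eq_iff mat_def matrix_vector_mult_def if_distrib[of "\<lambda>a. a * _"] cong: if_cong)

lemma shifted_vec: "shifted A \<sigma> *v x = A *v x - of_real \<sigma> *s x"
  by (simp add: matrix_vector_mult_diff_rdistrib mat_vec_eq_scale)

lemma hermitian_shifted:
  assumes "hermitian A"
  shows "hermitian (shifted A \<sigma>)"
  using hermitian_cdot[OF assms] by (intro hermitianI) (simp add: shifted_vec cdot_simps)

lemma hermitian_eigenvalue_real:
  assumes "hermitian A" "A *v x = lam *s x" "x \<noteq> 0"
  shows "lam = of_real (Re lam)"
proof -
  have "cnj lam * cdot x x = lam * cdot x x"
    using hermitian_cdot[OF assms(1), of x x] by (simp add: assms(2) cdot_simps)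
  then have "cnj lam = lam" using assms(3) by simp
  then show ?thesis by (simp add: complex_eq_iff)
qed

section \<open>Extremal eigenvectors on invariant subspaces\<close>

text \<open>Makes the topological facts on real subspaces, such as closedness, available for complex
  ones.\<close>

lemma vec_subspace_imp_subspace:
  assumes "vec.subspace (W :: (complex ^ 'n) set)"
  shows "subspace W"
  using assms unfolding subspace_def vec.subspace_def by (simp add: scaleR_vec_eq_scale)

lemma bounded_linear_matrix_vector: "bounded_linear ((*v) (A :: complex ^ 'n ^ 'n))"
  by (simp add: linear_linear[symmetric] linear_iff matrix_vector_right_distrib
      scaleR_vec_eq_scale vec.scale)

text \<open>For \<open>s = 1\<close> (\<open>s = - 1\<close>) take a minimiser (maximiser) \<open>z\<close> of \<open>norm (H *v z)\<close> on the unit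
  sphere of \<open>W\<close>, with value \<open>m\<close>. The first variation gives \<open>H (H z) = m\<^sup>2 z\<close>, so either \<open>H z = - m z\<close>
  or \<open>H z + m z\<close> is an eigenvector for \<open>m\<close>.\<close>

lemma hermitian_extremal_eigenvector:
  fixes H :: "complex ^ 'n ^ 'n"
  assumes H: "hermitian H" and W: "vec.subspace W" "\<And>z. z \<in> W \<Longrightarrow> H *v z \<in> W"
    and "z1 \<in> W" "z1 \<noteq> 0" and s: "s = 1 \<or> s = (- 1 :: real)"
  shows "\<exists>\<mu> z. z \<in> W \<and> z \<noteq> 0 \<and> H *v z = of_real \<mu> *s z \<and>
    (\<forall>y\<in>W. s * (\<bar>\<mu>\<bar> * norm y) \<le> s * norm (H *v y))"
proof -
  define C where "C = W \<inter> sphere 0 1"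
  have "compact C"
    unfolding C_def using vec_subspace_imp_subspace[OF W(1)]
    by (intro closed_Int_compact closed_subspace) auto
  have unit: "of_real (1 / norm y) *s y \<in> C" if "y \<in> W" "y \<noteq> 0" for y
    using that vec.subspace_scale[OF W(1)] by (simp add: C_def norm_vec_scale norm_divide)
  have "C \<noteq> {}" using unit[of z1] assms by blast
  have "continuous_on C (\<lambda>z. s * norm (H *v z))"
    by (intro continuous_intros bounded_linear.continuous_on[OF bounded_linear_matrix_vector])
  then obtain z where z: "z \<in> C" "\<And>y. y \<in> C \<Longrightarrow> s * norm (H *v z) \<le> s * norm (H *v y)"
    using continuous_attains_inf[OF \<open>compact C\<close> \<open>C \<noteq> {}\<close>] by blast
  define m where "m = norm (H *v z)"
  have "m \<ge> 0" by (simp add: m_def)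
  have zW: "z \<in> W" and z1: "norm z = 1" and "z \<noteq> 0" using z(1) by (auto simp: C_def)
  have ext: "s * (m * norm y) \<le> s * norm (H *v y)" if "y \<in> W" for y
  proof (cases "y = 0")
    case False
    have "s * m \<le> s * (norm (H *v y) / norm y)"
      using z(2)[OF unit[OF that False]]
      by (simp add: m_def vec.scale norm_vec_scale norm_divide)
    from mult_right_mono[OF this, of "norm y"] show ?thesis
      using False by (simp add: mult.assoc)
  qed simp
  \<comment> \<open>Squaring turns the extremality into a sign condition on a quadratic form, which
    vanishes at \<open>z\<close>.\<close>
  have form: "0 \<le> s * ((norm (H *v y))\<^sup>2 - m\<^sup>2 * (norm y)\<^sup>2)" if "y \<in> W" for y
    using s
  proof
    assume "s = 1"
    then have "m * norm y \<le> norm (H *v y)" using ext[OF that] by simp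
    then have "(m * norm y)\<^sup>2 \<le> (norm (H *v y))\<^sup>2"
      using \<open>m \<ge> 0\<close> by (intro power_mono) auto
    then show ?thesis using \<open>s = 1\<close> by (simp add: power_mult_distrib)
  next
    assume "s = - 1"
    then have "norm (H *v y) \<le> m * norm y" using ext[OF that] by simp
    then have "(norm (H *v y))\<^sup>2 \<le> (m * norm y)\<^sup>2"
      by (intro power_mono) auto
    then show ?thesis using \<open>s = - 1\<close> by (simp add: power_mult_distrib)
  qed
  define u where "u = H *v (H *v z) - of_real (m\<^sup>2) *s z"
  have uW: "u \<in> W"
    unfolding u_def using W zW by (intro vec.subspace_diff vec.subspace_scale) auto
  define g where "g = (norm (H *v u))\<^sup>2 - m\<^sup>2 * (norm u)\<^sup>2"
  \<comment> \<open>Half the linear coefficient of the form along \<open>z + t u\<close>;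
    \<open>u\<close> is its gradient direction.\<close>
  have cross: "Re (cdot (H *v z) (H *v u)) - m\<^sup>2 * Re (cdot z u) = (norm u)\<^sup>2"
  proof -
    have "cdot (H *v z) (H *v u) - of_real (m\<^sup>2) * cdot z u = cdot u u"
      using hermitian_cdot[OF H, of "H *v z" u]
      by (subst (3) u_def) (simp add: cdot_simps)
    from arg_cong[OF this, of Re] show ?thesis
      by (simp add: cdot_self)
  qed
  have quad: "0 \<le> s * (2 * t * (norm u)\<^sup>2 + t\<^sup>2 * g)" for t
  proof -
    have "z + of_real t *s u \<in> W"
      using W(1) zW uW by (intro vec.subspace_add vec.subspace_scale)
    from form[OF this] have "0 \<le> s * (m\<^sup>2 + 2 * t * Re (cdot (H *v z) (H *v u)) + t\<^sup>2 * (norm (H *v u))\<^sup>2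
        - m\<^sup>2 * (1 + 2 * t * Re (cdot z u) + t\<^sup>2 * (norm u)\<^sup>2))"
      by (simp only: matrix_vector_right_distrib vec.scale norm_add_real_scale z1
          m_def[symmetric] power_one)
    then show ?thesis unfolding g_def cross[symmetric] by (simp add: algebra_simps)
  qed
  have "u = 0"
  proof (rule ccontr)
    assume "u \<noteq> 0"
    then have N: "(norm u)\<^sup>2 > 0" by simp
    \<comment> \<open>For a step this short the quadratic term cannot outweigh the linear one, so
      \<open>t = - s * r\<close> makes the expression in \<open>quad\<close> negative.\<close>
    define r where "r = (norm u)\<^sup>2 / (\<bar>g\<bar> + 1)"
    have "r > 0" unfolding r_def using N by (intro divide_pos_pos) auto
    have "r * (\<bar>g\<bar> + 1) = (norm u)\<^sup>2" by (simp add: r_def)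
    moreover have "r * (s * g) \<le> r * (\<bar>g\<bar> + 1)"
      using s \<open>r > 0\<close> by (intro mult_left_mono) auto
    ultimately have "r * (s * g) - 2 * (norm u)\<^sup>2 < 0" using N by linarith
    then have "r * (r * (s * g) - 2 * (norm u)\<^sup>2) < 0" using \<open>r > 0\<close> by (simp add: mult_pos_neg)
    moreover have "s * (2 * (- s * r) * (norm u)\<^sup>2 + (- s * r)\<^sup>2 * g) =
        r * (r * (s * g) - 2 * (norm u)\<^sup>2)"
      using s by (auto simp: algebra_simps power2_eq_square)
    ultimately show False using quad[of "- s * r"] by linarith
  qed
  then have HH: "H *v (H *v z) = of_real (m\<^sup>2) *s z" by (simp add: u_def)
  define y where "y = H *v z + of_real m *s z"
  show ?thesis
  proof (cases "y = 0")
    case True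
    then have "H *v z = of_real (- m) *s z"
      by (simp add: y_def eq_neg_iff_add_eq_0)
    then show ?thesis
      using zW \<open>z \<noteq> 0\<close> ext \<open>m \<ge> 0\<close> by (intro exI[of _ "- m"] exI[of _ z]) simp
  next
    case False
    have "H *v y = of_real m *s y"
      by (simp add: y_def matrix_vector_right_distrib vec.scale HH vec.scale_right_distrib
          power2_eq_square add.commute)
    moreover have "y \<in> W"
      unfolding y_def using W zW by (intro vec.subspace_add vec.subspace_scale) auto
    ultimately show ?thesis
      using False ext \<open>m \<ge> 0\<close> by (intro exI[of _ m] exI[of _ y]) simp
  qed
qed

section \<open>Orthonormal eigenbases\<close>

definition orthonormal :: "(complex ^ 'n) set \<Rightarrow> bool"
  where "orthonormal E \<longleftrightarrow> (\<forall>e\<in>E. \<forall>f\<in>E. cdot e f = (if e = f then 1 else 0))"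

lemma orthonormal_independent:
  assumes "orthonormal E"
  shows "vec.independent E"
  unfolding vec.independent_explicit_module
proof (intro allI impI)
  fix t u v
  assume t: "finite t" "t \<subseteq> E" and sum: "(\<Sum>w\<in>t. u w *s w) = 0" and v: "v \<in> t"
  have "0 = cdot v (\<Sum>w\<in>t. u w *s w)" by (simp add: sum)
  also have "\<dots> = (\<Sum>w\<in>t. if w = v then u w else 0)"
    unfolding cdot_sum_right cdot_scale_right
  proof (intro sum.cong refl)
    fix w assume "w \<in> t"
    then have "cdot v w = (if v = w then 1 else 0)"
      using assms t v unfolding orthonormal_def by blast
    then show "u w * cdot v w = (if w = v then u w else 0)" by simp
  qed
  also have "\<dots> = u v" using t v by simp
  finally show "u v = 0" by simp
qed

lemma orthonormal_finite:
  assumes "orthonormal (E :: (complex ^ 'n) set)"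
  shows "finite E" "card E \<le> vec.dim (UNIV :: (complex ^ 'n) set)"
  using vec.independent_card_le_dim[OF subset_UNIV orthonormal_independent[OF assms]]
    vec.finiteI_independent[OF orthonormal_independent[OF assms]] by blast+

definition fourier_residual :: "(complex ^ 'n) set \<Rightarrow> complex ^ 'n \<Rightarrow> complex ^ 'n"
  where "fourier_residual E z = z - (\<Sum>e\<in>E. cdot e z *s e)"

lemma fourier_residual_orthogonal:
  assumes "orthonormal E" "e \<in> E"
  shows "cdot e (fourier_residual E z) = 0"
proof -
  have "(\<Sum>f\<in>E. cdot f z * cdot e f) = (\<Sum>f\<in>E. if f = e then cdot f z else 0)"
    using assms by (intro sum.cong) (auto simp: orthonormal_def)
  also have "\<dots> = cdot e z" using assms(2) orthonormal_finite(1)[OF assms(1)] by simp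
  finally show ?thesis
    by (simp add: fourier_residual_def cdot_diff_right cdot_sum_right cdot_scale_right)
qed

text \<open>An orthonormal set of eigenvectors of maximal size is a basis, since its orthogonal
  complement in \<open>W\<close> is invariant and would otherwise contain a further eigenvector.\<close>

lemma hermitian_eigenbasis:
  fixes H :: "complex ^ 'n ^ 'n"
  assumes H: "hermitian H" and W: "vec.subspace W" "\<And>z. z \<in> W \<Longrightarrow> H *v z \<in> W"
  shows "\<exists>E m. orthonormal E \<and> E \<subseteq> W \<and> (\<forall>e\<in>E. H *v e = of_real (m e) *s e) \<and>
    (\<forall>z\<in>W. (\<Sum>e\<in>E. cdot e z *s e) = z)"
proof -
  define good where "good E \<longleftrightarrow> orthonormal E \<and> E \<subseteq> W \<and>
    (\<forall>e\<in>E. \<exists>\<mu>. H *v e = complex_of_real \<mu> *s e)" for E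
  have "good {}" by (simp add: good_def orthonormal_def)
  \<comment> \<open>The dimension bounds the size of orthonormal sets, so a largest
    \<open>good\<close> set exists.\<close>
  moreover have "\<forall>E. good E \<longrightarrow> card E < Suc (vec.dim (UNIV :: (complex ^ 'n) set))"
    using orthonormal_finite(2) by (auto simp: good_def less_Suc_eq_le)
  ultimately obtain E where E: "good E" "\<And>F. good F \<Longrightarrow> card F \<le> card E"
    using ex_has_greatest_nat[of good "{}" card] by blast
  from E(1) have ortho: "orthonormal E" and EW: "E \<subseteq> W"
    by (auto simp: good_def)
  have "\<exists>m. \<forall>e\<in>E. H *v e = complex_of_real (m e) *s e"
    using E(1) unfolding good_def by (intro bchoice) blast
  then obtain m where m: "\<And>e. e \<in> E \<Longrightarrow> H *v e = complex_of_real (m e) *s e" by blast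
  define V where "V = {z \<in> W. \<forall>e\<in>E. cdot e z = 0}"
  have V: "vec.subspace V"
    using W(1) unfolding V_def vec.subspace_def by (auto simp: cdot_simps)
  have HV: "H *v z \<in> V" if "z \<in> V" for z
    using that W(2) hermitian_cdot[OF H, symmetric] by (auto simp: V_def m cdot_simps)
  have "z = 0" if zV: "z \<in> V" for z
  proof (rule ccontr)
    assume "z \<noteq> 0"
    then obtain \<mu> y where y: "y \<in> V" "y \<noteq> 0" "H *v y = of_real \<mu> *s y"
      using hermitian_extremal_eigenvector[where s = 1, OF H V HV zV \<open>z \<noteq> 0\<close>] by blast
    define f where "f = of_real (1 / norm y) *s y"
    have "f \<in> V" unfolding f_def using y V by (intro vec.subspace_scale) auto
    have "cdot f f = 1"
      using y(2) by (simp add: cdot_self f_def norm_vec_scale norm_divide)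
    moreover have "\<forall>e\<in>E. cdot e f = 0 \<and> cdot f e = 0"
      using \<open>f \<in> V\<close> cdot_eq_0_sym by (auto simp: V_def)
    moreover have "H *v f = of_real \<mu> *s f"
      by (simp add: f_def vec.scale y(3) mult.commute)
    ultimately have "good (insert f E)" "f \<notin> E"
      using E(1) \<open>f \<in> V\<close> by (auto simp: good_def orthonormal_def V_def)
    then show False
      using E(2)[of "insert f E"] orthonormal_finite(1)[OF ortho] by simp
  qed
  \<comment> \<open>As \<open>V\<close> is trivial, this residual vanishes, which is the expansion
    of \<open>z\<close> in \<open>E\<close>.\<close>
  moreover have "fourier_residual E z \<in> V" if "z \<in> W" for z
    using that fourier_residual_orthogonal[OF ortho] EW W(1)
    unfolding V_def fourier_residual_def
    by (auto intro!: vec.subspace_diff vec.subspace_sum vec.subspace_scale)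
  ultimately have "fourier_residual E z = 0" if "z \<in> W" for z
    using that by blast
  then have "\<forall>z\<in>W. (\<Sum>e\<in>E. cdot e z *s e) = z" by (simp add: fourier_residual_def)
  with ortho EW m show ?thesis by blast
qed

section \<open>Square roots of Hermitian positive definite matrices\<close>

text \<open>The sum of the rank-one matrices \<open>f(e) e e\<^sup>*\<close>. It provides the square
  root, with \<open>f = sqrt m\<close>, and the orthogonal projector, with
  \<open>f = 1\<close>.\<close>

definition spectral_matrix :: "(complex ^ 'n) set \<Rightarrow> (complex ^ 'n \<Rightarrow> real) \<Rightarrow> complex ^ 'n ^ 'n"
  where "spectral_matrix E f = (\<chi> i j. \<Sum>e\<in>E. of_real (f e) * e $ i * cnj (e $ j))"

lemma spectral_matrix_vec:
  "spectral_matrix E f *v z = (\<Sum>e\<in>E. (of_real (f e) * cdot e z) *s e)"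
proof -
  have "(spectral_matrix E f *v z) $ i = (\<Sum>e\<in>E. (of_real (f e) * cdot e z) *s e) $ i" for i
  proof -
    have "(spectral_matrix E f *v z) $ i =
        (\<Sum>j\<in>UNIV. \<Sum>e\<in>E. of_real (f e) * e $ i * cnj (e $ j) * z $ j)"
      by (simp add: spectral_matrix_def matrix_vector_mult_def sum_distrib_right)
    also have "\<dots> = (\<Sum>e\<in>E. \<Sum>j\<in>UNIV. of_real (f e) * e $ i * cnj (e $ j) * z $ j)"
      by (rule sum.swap)
    also have "\<dots> = (\<Sum>e\<in>E. (of_real (f e) * cdot e z) *s e) $ i"
      by (simp add: cdot_def sum_distrib_left sum_distrib_right mult_ac)
    finally show ?thesis .
  qed
  then show ?thesis by (simp add: vec_eq_iff)
qed

lemma hermitian_spectral_matrix: "hermitian (spectral_matrix E f)"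
  by (simp add: hermitian_def spectral_matrix_def vec_eq_iff mult_ac)

lemma spectral_matrix_basis:
  assumes "orthonormal E" "e \<in> E"
  shows "spectral_matrix E f *v e = of_real (f e) *s e"
proof -
  have "spectral_matrix E f *v e = (\<Sum>d\<in>E. if d = e then of_real (f d) *s d else 0)"
    unfolding spectral_matrix_vec using assms by (intro sum.cong) (auto simp: orthonormal_def)
  also have "\<dots> = of_real (f e) *s e"
    using assms(2) orthonormal_finite(1)[OF assms(1)] by simp
  finally show ?thesis .
qed

lemma matrix_eq_vec: "(\<And>z. A *v z = B *v z) \<Longrightarrow> A = (B :: complex ^ 'n ^ 'n)"
  by (simp add: matrix_eq)

lemma matrix_vec_sum: "A *v sum f E = (\<Sum>e\<in>E. (A :: complex ^ 'n ^ 'n) *v f e)"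
  by (induction E rule: infinite_finite_induct) (simp_all add: matrix_vector_right_distrib)

text \<open>On the eigenspace of \<open>T\<close> for \<open>\<mu>\<close>, a square root \<open>S\<close> acts as \<open>sqrt \<mu>\<close>,
  because \<open>S + sqrt \<mu>\<close> is injective and \<open>(S + sqrt \<mu>)(S - sqrt \<mu>) = T - \<mu> = 0\<close> there.\<close>

lemma hpd_root_on_eigenvector:
  assumes S: "hpd S" "S ** S = T" and z: "T *v z = of_real \<mu> *s z" and "\<mu> > 0"
  shows "S *v z = of_real (sqrt \<mu>) *s z"
proof (rule ccontr)
  define y where "y = S *v z - of_real (sqrt \<mu>) *s z"
  assume "S *v z \<noteq> of_real (sqrt \<mu>) *s z"
  then have "y \<noteq> 0" by (simp add: y_def)
  have "S *v (S *v z) = of_real \<mu> *s z"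
    using S(2) z by (simp add: matrix_vector_mul_assoc)
  moreover have "complex_of_real (sqrt \<mu>) * of_real (sqrt \<mu>) = of_real \<mu>"
    using \<open>\<mu> > 0\<close> by (simp flip: of_real_mult)
  ultimately have "S *v y = - (of_real (sqrt \<mu>) *s y)"
    by (simp add: y_def matrix_vector_mult_diff_distrib vec.scale vec.scale_right_diff_distrib)
  then have "S *v y = of_real (- sqrt \<mu>) *s y" by simp
  then have "cdot y (S *v y) = of_real (- sqrt \<mu> * (norm y)\<^sup>2)"
    by (simp only: cdot_scale_right cdot_self of_real_mult)
  moreover have "0 < Re (cdot y (S *v y))" using S(1) \<open>y \<noteq> 0\<close> by (simp add: hpd_def)
  ultimately have "0 < - sqrt \<mu> * (norm y)\<^sup>2" by simp
  moreover have "0 \<le> sqrt \<mu> * (norm y)\<^sup>2" using \<open>\<mu> > 0\<close> by simp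
  ultimately show False by simp
qed

lemma hpd_eigenvalue_pos:
  assumes "hpd T" "T *v z = of_real \<mu> *s z" "z \<noteq> 0"
  shows "\<mu> > 0"
proof -
  have "0 < Re (of_real \<mu> * cdot z z)"
    using assms by (auto simp: hpd_def cdot_scale_right[symmetric])
  then show ?thesis using assms(3) by (simp add: cdot_self zero_less_mult_iff)
qed

lemma hpd_eigenbasis:
  fixes T :: "complex ^ 'n ^ 'n"
  assumes "hpd T"
  obtains E m where "orthonormal E" "\<And>e. e \<in> E \<Longrightarrow> T *v e = of_real (m e) *s e"
    "\<And>z. (\<Sum>e\<in>E. cdot e z *s e) = z" "\<And>e. e \<in> E \<Longrightarrow> m e > 0"
proof -
  have "hermitian T" using assms by (simp add: hpd_def)
  then obtain E m where E: "orthonormal E" "E \<subseteq> UNIV"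
    "\<And>e. e \<in> E \<Longrightarrow> T *v e = of_real (m e) *s e"
    "\<And>z. z \<in> UNIV \<Longrightarrow> (\<Sum>e\<in>E. cdot e z *s e) = z"
    using hermitian_eigenbasis[OF _ vec.subspace_UNIV UNIV_I] by blast
  have "m e > 0" if "e \<in> E" for e
  proof (rule hpd_eigenvalue_pos[OF assms E(3)[OF that]])
    have "cdot e e = 1" using E(1) that by (simp add: orthonormal_def)
    then show "e \<noteq> 0" by auto
  qed
  with E show ?thesis using that[of E m] by blast
qed

text \<open>Both roots act as \<open>sqrt (m e)\<close> on each member \<open>e\<close> of an
  eigenbasis of \<open>T\<close>.\<close>

lemma hpd_root_unique:
  assumes "hpd T" "hpd S" "S ** S = T" "hpd S'" "S' ** S' = T"
  shows "S = S'"
proof (rule matrix_eq_vec)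
  fix z
  obtain E m where "orthonormal E" and E: "\<And>e. e \<in> E \<Longrightarrow> T *v e = of_real (m e) *s e"
    "\<And>z. (\<Sum>e\<in>E. cdot e z *s e) = z" "\<And>e. e \<in> E \<Longrightarrow> m e > 0"
    using hpd_eigenbasis[OF assms(1)] by blast
  have "S *v e = S' *v e" if "e \<in> E" for e
    using hpd_root_on_eigenvector[OF assms(2,3) E(1,3)[OF that]]
      hpd_root_on_eigenvector[OF assms(4,5) E(1,3)[OF that]] by simp
  then show "S *v z = S' *v z"
    by (subst (1 2) E(2)[of z, symmetric]) (simp add: matrix_vec_sum vec.scale)
qed

text \<open>Keep an eigenbasis of \<open>T\<close> and replace its eigenvalues by their square
  roots.\<close>

lemma hpd_root_exists:
  fixes T :: "complex ^ 'n ^ 'n"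
  assumes "hpd T"
  shows "\<exists>S. hpd S \<and> S ** S = T"
proof -
  obtain E m where E: "orthonormal E" "\<And>e. e \<in> E \<Longrightarrow> T *v e = of_real (m e) *s e"
    "\<And>z. (\<Sum>e\<in>E. cdot e z *s e) = z" "\<And>e. e \<in> E \<Longrightarrow> m e > 0"
    using hpd_eigenbasis[OF assms] by blast
  define S where "S = spectral_matrix E (\<lambda>e. sqrt (m e))"
  have "S ** S = T"
  proof (rule matrix_eq_vec)
    fix z
    have "S *v (S *v e) = T *v e" if "e \<in> E" for e
    proof -
      have "complex_of_real (sqrt (m e)) * of_real (sqrt (m e)) = of_real (m e)"
        using E(4)[OF that] by (simp flip: of_real_mult)
      then show ?thesis
        using that by (simp add: S_def spectral_matrix_basis[OF E(1)] vec.scale E(2))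
    qed
    then show "S ** S *v z = T *v z"
      by (subst (1 2) E(3)[of z, symmetric]) (simp add: matrix_vec_sum vec.scale matrix_vector_mul_assoc[symmetric])
  qed
  moreover have "0 < Re (cdot z (S *v z))" if "z \<noteq> 0" for z
  proof -
    have eq: "Re (cdot z (S *v z)) = (\<Sum>e\<in>E. sqrt (m e) * (cmod (cdot e z))\<^sup>2)"
    proof -
      have "cdot z (S *v z) = (\<Sum>e\<in>E. of_real (sqrt (m e) * (cmod (cdot e z))\<^sup>2))"
        unfolding S_def spectral_matrix_vec cdot_sum_right cdot_scale_right
          of_real_mult complex_norm_square cnj_cdot by (simp add: mult.assoc)
      then show ?thesis by simp
    qed
    \<comment> \<open>If all coefficients vanished, the expansion in \<open>E\<close> would give
      \<open>z = 0\<close>.\<close>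
    obtain e where "e \<in> E" "cdot e z \<noteq> 0"
    proof (rule ccontr)
      assume "\<not> thesis"
      then have "(\<Sum>e\<in>E. cdot e z *s e) = 0" using that by (intro sum.neutral) auto
      then show False using E(3)[of z] \<open>z \<noteq> 0\<close> by simp
    qed
    then show ?thesis
      unfolding eq using E(4) orthonormal_finite(1)[OF E(1)]
      by (intro sum_pos2[of _ e]) (auto simp: less_imp_le)
  qed
  ultimately show ?thesis
    by (intro exI[of _ S]) (simp add: hpd_def S_def hermitian_spectral_matrix)
qed

lemma hpd_sqrt:
  assumes "hpd T"
  shows "hpd (hpd_sqrt T)" "hpd_sqrt T ** hpd_sqrt T = T"
proof -
  have "\<exists>!S. hpd S \<and> S ** S = T"
    using hpd_root_exists[OF assms] hpd_root_unique[OF assms] by blast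
  from theI'[OF this] show "hpd (hpd_sqrt T)" "hpd_sqrt T ** hpd_sqrt T = T"
    by (simp_all add: hpd_sqrt_def)
qed

text \<open>\<open>A\<close> maps every eigenspace of \<open>T\<close> into itself, and the root
  acts as a scalar there.\<close>

lemma hpd_sqrt_commute:
  assumes "hpd T" "T ** A = A ** T"
  shows "hpd_sqrt T ** A = A ** hpd_sqrt T"
proof (rule matrix_eq_vec)
  fix z
  obtain E m where "orthonormal E" and E: "\<And>e. e \<in> E \<Longrightarrow> T *v e = of_real (m e) *s e"
    "\<And>z. (\<Sum>e\<in>E. cdot e z *s e) = z" "\<And>e. e \<in> E \<Longrightarrow> m e > 0"
    using hpd_eigenbasis[OF assms(1)] by blast
  have "hpd_sqrt T *v (A *v e) = A *v (hpd_sqrt T *v e)" if "e \<in> E" for e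
  proof -
    have "T *v (A *v e) = of_real (m e) *s (A *v e)"
      using assms(2) E(1)[OF that] by (metis matrix_vector_mul_assoc vec.scale)
    then show ?thesis
      using hpd_root_on_eigenvector[OF hpd_sqrt[OF assms(1)] _ E(3)[OF that]] E(1)[OF that]
      by (simp add: vec.scale)
  qed
  then show "hpd_sqrt T ** A *v z = A ** hpd_sqrt T *v z"
    by (subst (1 2) E(2)[of z, symmetric]) (simp add: matrix_vec_sum vec.scale matrix_vector_mul_assoc[symmetric])
qed

section \<open>Orthogonal projectors: existence and uniqueness\<close>

lemma orth_projector:
  fixes Q :: "(complex ^ 'n) set"
  assumes "vec.subspace Q"
  shows "hermitian (orth_projector Q)" "orth_projector Q *v z \<in> Q"
    "z \<in> Q \<Longrightarrow> orth_projector Q *v z = z"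
proof -
  \<comment> \<open>Every subspace is invariant under the zero matrix, so its eigenbasis is simply
    an orthonormal basis of \<open>Q\<close>.\<close>
  have "hermitian (mat 0 :: complex ^ 'n ^ 'n)"
    by (intro hermitianI) (simp add: mat_vec_eq_scale)
  moreover have "mat 0 *v z \<in> Q" for z
    using vec.subspace_0[OF assms] by (simp add: mat_vec_eq_scale)
  ultimately obtain E m where E: "orthonormal E" "E \<subseteq> Q"
      "\<And>e. e \<in> E \<Longrightarrow> mat 0 *v e = complex_of_real (m e) *s e"
      "\<And>z. z \<in> Q \<Longrightarrow> (\<Sum>e\<in>E. cdot e z *s e) = z"
    using hermitian_eigenbasis[OF _ assms] by blast
  define P where "P = spectral_matrix E (\<lambda>_. 1)"
  have PQ: "P *v z \<in> Q" for z
    unfolding P_def spectral_matrix_vec using E(2) assms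
    by (intro vec.subspace_sum vec.subspace_scale) auto
  have Pid: "P *v z = z" if "z \<in> Q" for z
    using E(4)[OF that] by (simp add: P_def spectral_matrix_vec)
  let ?proj = "\<lambda>P. hermitian P \<and> P ** P = P \<and> range ((*v) P) = Q"
  have "?proj P"
  proof (intro conjI)
    show "hermitian P" by (simp add: P_def hermitian_spectral_matrix)
    show "P ** P = P"
      by (intro matrix_eq_vec) (simp add: matrix_vector_mul_assoc[symmetric] Pid PQ)
    show "range ((*v) P) = Q" using PQ Pid by (auto simp: image_iff) metis
  qed
  \<comment> \<open>Equal ranges give \<open>P2 P1 = P1\<close> and \<open>P1 P2 = P2\<close>; these
    products are adjoint to each other.\<close>
  moreover have "P1 = P2" if "?proj P1" "?proj P2" for P1 P2
  proof -
    have fix_range: "P' *v q = q" if "?proj P'" "q \<in> Q" for P' q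
      using that by (metis imageE matrix_vector_mul_assoc)
    have in_range: "P' *v z \<in> Q" if "?proj P'" for P' z
      using that by blast
    have "cdot (P1 *v x) y = cdot (P2 *v x) y" for x y
    proof -
      have "cdot (P1 *v x) y = cdot (P2 *v (P1 *v x)) y"
        using that by (simp add: fix_range in_range)
      also have "\<dots> = cdot x (P1 *v (P2 *v y))"
        using that by (simp add: hermitian_cdot)
      also have "\<dots> = cdot (P2 *v x) y"
        using that by (simp add: fix_range in_range hermitian_cdot)
      finally show ?thesis .
    qed
    then have "cdot (P1 *v x - P2 *v x) (P1 *v x - P2 *v x) = 0" for x
      by (simp add: cdot_diff_left)
    then show ?thesis by (intro matrix_eq_vec) simp
  qed
  ultimately have "orth_projector Q = P"
    unfolding orth_projector_def by (intro the_equality) blast+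
  then show "hermitian (orth_projector Q)" "orth_projector Q *v z \<in> Q"
    "z \<in> Q \<Longrightarrow> orth_projector Q *v z = z"
    using \<open>?proj P\<close> PQ Pid by auto
qed

section \<open>Matrix norms and the condition number\<close>

text \<open>Cauchy-Schwarz for each row of \<open>M\<close>, summed over the rows.\<close>

lemma norm_matrix_vec_le_frobenius: "norm (M *v z) \<le> frobenius_norm M * norm z"
proof -
  have "(cmod ((M *v z) $ i))\<^sup>2 \<le> (\<Sum>j\<in>UNIV. (cmod (M $ i $ j))\<^sup>2) * (norm z)\<^sup>2" for i
  proof -
    have e: "(M *v z) $ i = cdot (\<chi> j. cnj (M $ i $ j)) z"
      by (simp add: matrix_vector_mult_def cdot_def)
    have "cmod ((M *v z) $ i) \<le> norm (\<chi> j. cnj (M $ i $ j)) * norm z"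
      unfolding e by (rule cmod_cdot_le)
    then have "(cmod ((M *v z) $ i))\<^sup>2 \<le> (norm (\<chi> j. cnj (M $ i $ j)) * norm z)\<^sup>2"
      by (intro power_mono) auto
    then show ?thesis
      by (simp add: power_mult_distrib norm_vec_def L2_set_def sum_nonneg)
  qed
  then have "(\<Sum>i\<in>UNIV. (cmod ((M *v z) $ i))\<^sup>2)
      \<le> (\<Sum>i\<in>UNIV. (\<Sum>j\<in>UNIV. (cmod (M $ i $ j))\<^sup>2) * (norm z)\<^sup>2)"
    by (intro sum_mono)
  also have "\<dots> = (frobenius_norm M * norm z)\<^sup>2"
    by (simp add: frobenius_norm_def power_mult_distrib sum_nonneg sum_distrib_right)
  finally have "(norm (M *v z))\<^sup>2 \<le> (frobenius_norm M * norm z)\<^sup>2"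
    by (simp add: norm_vec_def[of "M *v z"] L2_set_def sum_nonneg)
  then show ?thesis
    by (rule power2_le_imp_le) (simp add: frobenius_norm_def sum_nonneg)
qed

lemma norm_matrix_vec_le:
  assumes "mnorm = spectral_norm \<or> mnorm = frobenius_norm"
  shows "norm (M *v z) \<le> mnorm M * norm z"
  using assms onorm[OF bounded_linear_matrix_vector] norm_matrix_vec_le_frobenius
  by (auto simp: spectral_norm_def)

text \<open>The least and the greatest value of \<open>norm (B *v z) / norm z\<close> are attained
  at eigenvectors, hence equal the extreme moduli of eigenvalues.\<close>

lemma cond_number_bounds:
  fixes B :: "complex ^ 'n ^ 'n"
  assumes B: "hermitian B" and inj: "\<And>z. B *v z = 0 \<Longrightarrow> z = 0"
  obtains a b where "a > 0" "b > 0" "cond_number B = b / a"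
    "\<And>z. norm (B *v z) \<le> b * norm z" "\<And>z. a * norm z \<le> norm (B *v z)"
proof -
  have pos: "cmod \<nu> > 0" if "\<nu> \<in> spectrum B" for \<nu>
    using that inj by (fastforce simp: spectrum_def eigenpair_def)
  \<comment> \<open>Any nonzero vector serves here; the extremal lemma asks for one.\<close>
  have e: "(axis undefined 1 :: complex ^ 'n) \<noteq> 0" by (simp add: axis_eq_0_iff)
  have ratio: "\<exists>z. z \<noteq> 0 \<and> norm (B *v z) = cmod \<nu> * norm z" if "\<nu> \<in> spectrum B" for \<nu>
    using that by (auto simp: spectrum_def eigenpair_def norm_vec_scale)
  obtain \<mu> z where \<mu>: "z \<noteq> 0" "B *v z = of_real \<mu> *s z"
    and "\<forall>y\<in>UNIV. 1 * (\<bar>\<mu>\<bar> * norm y) \<le> 1 * norm (B *v y)"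
    using hermitian_extremal_eigenvector[where s = "1", OF B vec.subspace_UNIV UNIV_I UNIV_I e]
    by blast
  then have min_le: "\<bar>\<mu>\<bar> * norm y \<le> norm (B *v y)" for y by simp
  define \<nu>min where "\<nu>min = arg_min cmod (\<lambda>\<nu>. \<nu> \<in> spectrum B)"
  have min: "\<nu>min \<in> spectrum B \<and> cmod \<nu>min = \<bar>\<mu>\<bar>"
  proof -
    have s: "of_real \<mu> \<in> spectrum B" using \<mu>(1,2) by (auto simp: spectrum_def eigenpair_def)
    have le: "\<bar>\<mu>\<bar> \<le> cmod \<nu>" if \<nu>: "\<nu> \<in> spectrum B" for \<nu>
    proof -
      obtain y where "y \<noteq> 0" "norm (B *v y) = cmod \<nu> * norm y" using ratio[OF \<nu>] by blast
      then show ?thesis using min_le[of y] by simp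
    qed
    \<comment> \<open>The choice made by \<open>arg_min\<close> is controlled only once some
      minimiser is known; \<open>of_real \<mu>\<close> is one, and all minimisers share its
      modulus.\<close>
    show ?thesis unfolding \<nu>min_def
    proof (rule arg_minI[of _ "of_real \<mu>"])
      fix \<nu> assume \<nu>: "\<nu> \<in> spectrum B"
      then show "\<not> cmod \<nu> < cmod (of_real \<mu>)" using le by (simp add: not_less)
      assume "\<forall>\<nu>'. \<nu>' \<in> spectrum B \<longrightarrow> \<not> cmod \<nu>' < cmod \<nu>"
      then have "\<not> cmod (of_real \<mu>) < cmod \<nu>" using s by blast
      then show "\<nu> \<in> spectrum B \<and> cmod \<nu> = \<bar>\<mu>\<bar>"
        using le[OF \<nu>] \<nu> by simp
    qed (use s in simp)
  qed
  obtain \<tau> z' where \<tau>: "z' \<noteq> 0" "B *v z' = of_real \<tau> *s z'"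
    and "\<forall>y\<in>UNIV. - 1 * (\<bar>\<tau>\<bar> * norm y) \<le> - 1 * norm (B *v y)"
    using hermitian_extremal_eigenvector[where s = "- 1", OF B vec.subspace_UNIV UNIV_I UNIV_I e]
    by blast
  then have le_max: "norm (B *v y) \<le> \<bar>\<tau>\<bar> * norm y" for y by simp
  define \<nu>max where "\<nu>max = arg_max cmod (\<lambda>\<nu>. \<nu> \<in> spectrum B)"
  have max: "\<nu>max \<in> spectrum B \<and> cmod \<nu>max = \<bar>\<tau>\<bar>"
  proof -
    have s: "of_real \<tau> \<in> spectrum B" using \<tau>(1,2) by (auto simp: spectrum_def eigenpair_def)
    have le: "cmod \<nu> \<le> \<bar>\<tau>\<bar>" if \<nu>: "\<nu> \<in> spectrum B" for \<nu>
    proof -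
      obtain y where "y \<noteq> 0" "norm (B *v y) = cmod \<nu> * norm y" using ratio[OF \<nu>] by blast
      then show ?thesis using le_max[of y] by simp
    qed
    show ?thesis unfolding \<nu>max_def
    proof (rule arg_maxI[of _ "of_real \<tau>"])
      fix \<nu> assume \<nu>: "\<nu> \<in> spectrum B"
      then show "\<not> cmod (of_real \<tau>) < cmod \<nu>" using le by (simp add: not_less)
      assume "\<forall>\<nu>'. \<nu>' \<in> spectrum B \<longrightarrow> \<not> cmod \<nu> < cmod \<nu>'"
      then have "\<not> cmod \<nu> < cmod (of_real \<tau>)" using s by blast
      then show "\<nu> \<in> spectrum B \<and> cmod \<nu> = \<bar>\<tau>\<bar>"
        using le[OF \<nu>] \<nu> by simp
    qed (use s in simp)
  qed
  have "cond_number B = \<bar>\<tau>\<bar> / \<bar>\<mu>\<bar>"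
    using min max by (simp add: cond_number_def Let_def \<nu>min_def \<nu>max_def norm_divide)
  moreover have "\<bar>\<mu>\<bar> > 0" "\<bar>\<tau>\<bar> > 0"
    using pos min max by metis+
  ultimately show ?thesis using that[of "\<bar>\<mu>\<bar>" "\<bar>\<tau>\<bar>"] min_le le_max by blast
qed

section \<open>Projection residuals and the Rayleigh-Ritz estimate\<close>

lemma orth_projector_orthogonal:
  assumes "vec.subspace Q" "q \<in> Q"
  shows "cdot q (orth_projector Q *v z) = cdot q z"
  using hermitian_cdot[OF orth_projector(1)[OF assms(1)], of q z] orth_projector(3)[OF assms]
  by simp

text \<open>Testing the orthogonality against \<open>P z\<close> itself gives
  \<open>norm (P z) = 0\<close>.\<close>

lemma orth_projector_eq_0:
  assumes "vec.subspace Q" "\<And>q. q \<in> Q \<Longrightarrow> cdot z q = 0"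
  shows "orth_projector Q *v z = 0"
proof -
  have "cdot z (orth_projector Q *v z) = 0"
    using assms orth_projector(2) by blast
  then have "cdot (orth_projector Q *v z) z = 0"
    using cdot_eq_0_sym by blast
  then show ?thesis
    using orth_projector_orthogonal[OF assms(1) orth_projector(2)[OF assms(1)], of z z] by simp
qed

lemma norm_orth_projector_residual_le:
  assumes Q: "vec.subspace Q" "q \<in> Q"
  shows "norm (y - orth_projector Q *v y) \<le> norm (y - q)"
proof -
  let ?p = "orth_projector Q *v y"
  have "?p - q \<in> Q" using Q orth_projector(2) by (intro vec.subspace_diff) auto
  then have "cdot (?p - q) (y - ?p) = 0"
    using orth_projector_orthogonal[OF Q(1)] by (simp add: cdot_diff_right)
  from norm_add_orthogonal[OF this] have "(norm (y - ?p))\<^sup>2 \<le> (norm (y - q))\<^sup>2" by simp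
  then show ?thesis by (rule power2_le_imp_le) simp
qed

text \<open>On \<open>W\<close> the smallest stretching factor of \<open>G - \<eta>\<close> is the
  modulus of one of its eigenvalues, that is, a distance from \<open>\<eta>\<close> to an eigenvalue
  of \<open>G\<close>. The constant \<open>c\<close> is a reciprocal gap; \<open>c = 0\<close> is
  possible only if \<open>W\<close> is trivial.\<close>

lemma norm_le_gap_mult_norm_residual:
  fixes G :: "complex ^ 'n ^ 'n"
  assumes G: "hermitian G" and W: "vec.subspace W" "\<And>z. z \<in> W \<Longrightarrow> G *v z \<in> W"
    and gap: "\<And>\<mu> z. z \<in> W \<Longrightarrow> z \<noteq> 0 \<Longrightarrow> G *v z = of_real \<mu> *s z \<Longrightarrow> 1 \<le> c * \<bar>\<mu> - \<eta>\<bar>"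
    and "0 \<le> c" "z \<in> W"
  shows "norm z \<le> c * norm (G *v z - of_real \<eta> *s z)"
proof (cases "z = 0")
  case False
  have inv: "shifted G \<eta> *v y \<in> W" if "y \<in> W" for y
    unfolding shifted_vec using that W by (intro vec.subspace_diff vec.subspace_scale) auto
  obtain \<mu> u where u: "u \<in> W" "u \<noteq> 0" "shifted G \<eta> *v u = of_real \<mu> *s u"
    and ext: "\<forall>y\<in>W. 1 * (\<bar>\<mu>\<bar> * norm y) \<le> 1 * norm (shifted G \<eta> *v y)"
    using hermitian_extremal_eigenvector[where s = 1, OF hermitian_shifted[OF G] W(1) inv
        \<open>z \<in> W\<close> False] by blast
  have "G *v u = of_real (\<mu> + \<eta>) *s u"
    using u(3) unfolding shifted_vec by (simp add: diff_eq_eq vec.scale_left_distrib)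
  then have "1 \<le> c * \<bar>\<mu>\<bar>" using gap[OF u(1,2), of "\<mu> + \<eta>"] by simp
  then have "1 * norm z \<le> c * \<bar>\<mu>\<bar> * norm z"
    by (intro mult_right_mono) auto
  also have "\<dots> = c * (\<bar>\<mu>\<bar> * norm z)" by simp
  also have "\<dots> \<le> c * norm (shifted G \<eta> *v z)"
    using ext \<open>z \<in> W\<close> \<open>0 \<le> c\<close> by (intro mult_left_mono) auto
  finally show ?thesis by (simp add: shifted_vec)
qed simp

lemma rayleigh_ritz_vector_bound:
  fixes H :: "complex ^ 'n ^ 'n" and Q :: "(complex ^ 'n) set"
  defines "P \<equiv> orth_projector Q"
  assumes H: "hermitian H" and Q: "vec.subspace Q"
    and y: "H *v y = of_real \<eta> *s y"
    and w: "w \<in> Q" "w \<noteq> 0" "P *v (H *v w) = \<mu> *s w"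
    and "0 \<le> c"
    and gap: "\<And>z. z \<in> Q \<Longrightarrow> cdot w z = 0 \<Longrightarrow>
      norm z \<le> c * norm (P *v (H *v z) - of_real \<eta> *s z)"
    and \<gamma>: "\<And>z. norm (P ** H ** (mat 1 - P) *v z) \<le> \<gamma> * norm z"
  obtains a where "(norm (y - a *s w))\<^sup>2 \<le> (1 + (c * \<gamma>)\<^sup>2) * (norm (y - P *v y))\<^sup>2"
proof -
  note PQ = orth_projector(2)[OF Q, folded P_def] and Pid = orth_projector(3)[OF Q, folded P_def]
  note Porth = orth_projector_orthogonal[OF Q, folded P_def]
  define p r where "p = P *v y" and "r = y - p"
  \<comment> \<open>This makes \<open>a *s w\<close> the orthogonal projection of \<open>p\<close>
    onto the line of \<open>w\<close>.\<close>
  define a where "a = cdot w p / cdot w w"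
  define z where "z = p - a *s w"
  define L where "L u = P *v (H *v u) - of_real \<eta> *s u" for u
  have zQ: "z \<in> Q"
    unfolding z_def p_def using Q w(1) PQ by (intro vec.subspace_diff vec.subspace_scale) auto
  have wz: "cdot w z = 0"
    using w(2) by (simp add: z_def a_def cdot_simps)
  have "cdot z r = 0"
    using Porth[OF zQ] by (simp add: r_def p_def cdot_diff_right)
  from norm_add_orthogonal[OF this]
  have pyth: "(norm (y - a *s w))\<^sup>2 = (norm z)\<^sup>2 + (norm r)\<^sup>2"
    by (simp add: z_def r_def)
  \<comment> \<open>Since \<open>(H - \<eta>) y = 0\<close>, the vectors \<open>p\<close> and
    \<open>r\<close> have opposite images under \<open>P (H - \<eta>)\<close>, and
    \<open>P r = 0\<close> removes the shift on \<open>r\<close>.\<close>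
  have Lp: "L p = - (P ** H ** (mat 1 - P) *v r)"
  proof -
    have "P *v r = 0"
      by (simp add: r_def p_def matrix_vector_mult_diff_distrib Pid PQ)
    then have "P ** H ** (mat 1 - P) *v r = P *v (H *v r)"
      by (simp add: matrix_vector_mul_assoc[symmetric] matrix_vector_mult_diff_rdistrib)
    also have "\<dots> = P *v (of_real \<eta> *s y) - P *v (H *v p)"
      by (simp add: r_def matrix_vector_mult_diff_distrib y)
    also have "\<dots> = - L p"
      by (simp add: L_def vec.scale p_def)
    finally show ?thesis by simp
  qed
  have "L p = (a * (\<mu> - of_real \<eta>)) *s w + L z"
    by (simp add: L_def z_def matrix_vector_mult_diff_distrib vec.scale w(3)
        vec.scale_right_diff_distrib vec.scale_left_diff_distrib algebra_simps)
  \<comment> \<open>\<open>P H\<close> is self-adjoint on \<open>Q\<close> with eigenvector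
    \<open>w\<close>, so \<open>L z\<close> stays orthogonal to \<open>w\<close> and is an
    orthogonal component of \<open>L p\<close>.\<close>
  moreover have "cdot ((a * (\<mu> - of_real \<eta>)) *s w) (L z) = 0"
  proof -
    have "cdot w (P *v (H *v z)) = cdot (H *v w) z"
      using Porth[OF w(1)] hermitian_cdot[OF H] by simp
    also have "\<dots> = cdot (P *v (H *v w)) z"
      using Porth[OF zQ, of "H *v w"] by (metis cnj_cdot)
    also have "\<dots> = 0" by (simp add: w(3) cdot_simps wz)
    finally show ?thesis by (simp add: L_def cdot_simps wz)
  qed
  ultimately have "(norm (L p))\<^sup>2 = (norm ((a * (\<mu> - of_real \<eta>)) *s w))\<^sup>2 + (norm (L z))\<^sup>2"
    using norm_add_orthogonal[of "(a * (\<mu> - of_real \<eta>)) *s w" "L z"] by simp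
  then have "(norm (L z))\<^sup>2 \<le> (norm (L p))\<^sup>2"
    using zero_le_power2 by (metis le_add_same_cancel2)
  then have "norm (L z) \<le> norm (L p)" by (rule power2_le_imp_le) simp
  also have "\<dots> \<le> \<gamma> * norm r" unfolding Lp using \<gamma> by simp
  finally have "norm (L z) \<le> \<gamma> * norm r" .
  then have "norm z \<le> c * (\<gamma> * norm r)"
    using gap[OF zQ wz] \<open>0 \<le> c\<close> unfolding L_def[symmetric] by (meson mult_left_mono order_trans)
  then have "(norm z)\<^sup>2 \<le> (c * (\<gamma> * norm r))\<^sup>2" by (intro power_mono) auto
  then have "(norm (y - a *s w))\<^sup>2 \<le> (1 + (c * \<gamma>)\<^sup>2) * (norm (y - P *v y))\<^sup>2"
    unfolding pyth by (simp add: r_def p_def power_mult_distrib algebra_simps)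
  then show ?thesis using that by blast
qed

text \<open>\<open>c\<close> stands for \<open>1 / \<delta>\<close>, which is \<open>0\<close> for an empty \<open>\<Theta>\<close>.\<close>

lemma min_gap_nonzero_cases:
  assumes "min_gap lam \<sigma> \<Theta> \<noteq> 0"
  obtains c where "0 \<le> c" "\<And>t. t \<in># \<Theta> \<Longrightarrow> 1 \<le> c * ritz_gap lam \<sigma> t"
    "\<And>\<gamma>. real_of_ereal (ereal (\<gamma>\<^sup>2) / (min_gap lam \<sigma> \<Theta>)\<^sup>2) = (c * \<gamma>)\<^sup>2"
proof (cases "\<Theta> = {#}")
  case True
  \<comment> \<open>With an infinite gap the quotient is \<open>0\<close>, in accordance with
    \<open>c = 0\<close>.\<close>
  then have "min_gap lam \<sigma> \<Theta> = \<infinity>" by (simp add: min_gap_def top_ereal_def)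
  then show ?thesis using that[of 0] True by (simp add: power2_eq_square)
next
  case False
  then obtain t0 where "t0 \<in># \<Theta>" by blast
  have nonneg: "0 \<le> ritz_gap lam \<sigma> t" for t by (cases t) auto
  have le: "min_gap lam \<sigma> \<Theta> \<le> ereal (ritz_gap lam \<sigma> t)" if "t \<in># \<Theta>" for t
    using that unfolding min_gap_def by (intro INF_lower) auto
  have "0 \<le> min_gap lam \<sigma> \<Theta>"
    unfolding min_gap_def using nonneg by (intro INF_greatest) auto
  \<comment> \<open>The gap of \<open>t0\<close> excludes the value \<open>\<infinity>\<close>, and
    the assumption excludes \<open>0\<close>.\<close>
  with assms le[OF \<open>t0 \<in># \<Theta>\<close>] obtain d where d: "min_gap lam \<sigma> \<Theta> = ereal d" "d > 0"
    by (cases "min_gap lam \<sigma> \<Theta>") auto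
  show ?thesis
  proof (rule that[of "1 / d"])
    show "1 \<le> 1 / d * ritz_gap lam \<sigma> t" if "t \<in># \<Theta>" for t
      using le[OF that] d by (simp add: field_simps)
    show "real_of_ereal (ereal (\<gamma>\<^sup>2) / (min_gap lam \<sigma> \<Theta>)\<^sup>2) = (1 / d * \<gamma>)\<^sup>2" for \<gamma>
      using d by (simp add: power2_eq_square)
  qed (use d in simp)
qed

section \<open>Harmonic Ritz pairs as Ritz pairs of the inverse of the shifted matrix\<close>

locale harmonic_ritz =
  fixes A T :: "complex ^ 'n ^ 'n" and K :: "(complex ^ 'n) set" and \<sigma> :: real
  assumes A: "hermitian A" and T: "hpd T" and commute: "T ** A = A ** T"
    and K: "vec.subspace K" and shift: "complex_of_real \<sigma> \<notin> spectrum A"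
begin

abbreviation "R \<equiv> hpd_sqrt T"
abbreviation "S \<equiv> shifted A \<sigma>"
abbreviation "H \<equiv> matrix_inv S"
definition "B = R ** S"
definition "Q = (*v) B ` K"
abbreviation "P \<equiv> orth_projector Q"

lemma hermitian_R: "hermitian R"
  using hpd_sqrt(1)[OF T] by (simp add: hpd_def)

lemma S_inj:
  assumes "S *v z = 0"
  shows "z = 0"
proof (rule ccontr)
  assume "z \<noteq> 0"
  moreover have "A *v z = of_real \<sigma> *s z" using assms by (simp add: shifted_vec)
  ultimately show False using shift by (auto simp: spectrum_def eigenpair_def)
qed

lemma R_inj:
  assumes "R *v z = 0"
  shows "z = 0"
  using assms hpd_sqrt(1)[OF T] by (force simp: hpd_def)

text \<open>Injectivity gives a left inverse, which is two-sided for square matrices, so the choice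
  inside \<open>matrix_inv\<close> succeeds.\<close>

lemma inverse_S: "S ** H = mat 1" "H ** S = mat 1"
proof -
  obtain X where "X ** S = mat 1" using S_inj matrix_left_invertible_ker by blast
  then have "\<exists>X. S ** X = mat 1 \<and> X ** S = mat 1"
    using matrix_left_right_inverse by blast
  from someI_ex[OF this] show "S ** H = mat 1" "H ** S = mat 1"
    by (simp_all add: matrix_inv_def)
qed

lemma HS: "H *v (S *v z) = z" and SH: "S *v (H *v z) = z"
  by (simp_all add: matrix_vector_mul_assoc inverse_S)

lemma hermitian_H: "hermitian H"
  by (intro hermitianI) (metis SH hermitian_cdot[OF hermitian_shifted[OF A]])

lemma RA: "R *v (A *v z) = A *v (R *v z)"
  using hpd_sqrt_commute[OF T commute] by (simp add: matrix_vector_mul_assoc)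

lemma RS: "R *v (S *v z) = S *v (R *v z)"
  unfolding shifted_vec by (simp add: matrix_vector_mult_diff_distrib vec.scale RA)

lemma B_vec: "B *v z = R *v (S *v z)"
  by (simp add: B_def matrix_vector_mul_assoc)

lemma B_in_Q: "v \<in> K \<Longrightarrow> B *v v \<in> Q"
  by (simp add: Q_def)

text \<open>\<open>R\<close> and \<open>S\<close> commute, so \<open>H\<close> cancels the factor
  \<open>S\<close> of \<open>B\<close>.\<close>

lemma HB: "H *v (B *v z) = R *v z"
  by (simp add: B_vec RS HS)

lemma hermitian_B: "hermitian B"
  by (intro hermitianI)
    (simp add: B_vec hermitian_cdot[OF hermitian_R] hermitian_cdot[OF hermitian_shifted[OF A]] RS)

lemma B_inj: "B *v z = 0 \<Longrightarrow> z = 0"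
  using R_inj S_inj by (metis B_vec)

lemma subspace_Q: "vec.subspace Q"
  unfolding Q_def by (rule vec.subspace_image[OF K])

lemma hermitian_P: "hermitian P"
  by (rule orth_projector(1)[OF subspace_Q])

text \<open>The second factor \<open>P\<close> makes this Hermitian on the whole space, so the
  eigenvector lemmas apply; on \<open>Q\<close> it agrees with \<open>P H\<close>.\<close>

definition compression where "compression = P ** H ** P"

lemma compression_vec: "z \<in> Q \<Longrightarrow> compression *v z = P *v (H *v z)"
  by (simp add: compression_def matrix_vector_mul_assoc[symmetric] orth_projector(3)[OF subspace_Q])

lemma hermitian_compression: "hermitian compression"
  unfolding compression_def
  by (intro hermitianI)
    (simp add: matrix_vector_mul_assoc[symmetric] hermitian_cdot[OF hermitian_P]
      hermitian_cdot[OF hermitian_H])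

lemma compression_in: "compression *v z \<in> Q"
  by (simp add: compression_def matrix_vector_mul_assoc[symmetric] orth_projector(2)[OF subspace_Q])

text \<open>Splitting \<open>T = R R\<close> turns \<open>T\<close>-orthogonality to
  \<open>S K\<close> into ordinary orthogonality to \<open>Q\<close>.\<close>

lemma cdot_T_S: "cdot z (T *v (S *v u)) = cdot (R *v z) (B *v u)"
proof -
  have "T *v (S *v u) = R *v (B *v u)"
    by (metis B_vec hpd_sqrt(2)[OF T] matrix_vector_mul_assoc)
  then show ?thesis by (simp add: hermitian_cdot[OF hermitian_R])
qed

text \<open>The residual, multiplied by \<open>R\<close>, is orthogonal to \<open>Q\<close> exactly
  if \<open>P\<close> annihilates it, and \<open>P R v = P H B v\<close>.\<close>

lemma harmonic_ritz_pair_iff: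
  "harmonic_ritz_pair T A K \<sigma> \<theta> v \<longleftrightarrow>
    v \<in> K \<and> v \<noteq> 0 \<and> B *v v = (\<theta> - of_real \<sigma>) *s (compression *v (B *v v))"
proof (cases "v \<in> K")
  case True
  then have BQ: "B *v v \<in> Q" by (rule B_in_Q)
  define z where "z = B *v v - (\<theta> - of_real \<sigma>) *s (R *v v)"
  have "R *v (A *v v - \<theta> *s v) = z"
  proof -
    have "A *v v - \<theta> *s v = S *v v - (\<theta> - of_real \<sigma>) *s v"
      unfolding shifted_vec by (simp add: vec.scale_left_diff_distrib)
    then have "R *v (A *v v - \<theta> *s v) = R *v (S *v v - (\<theta> - of_real \<sigma>) *s v)"
      by (rule arg_cong)
    also have "\<dots> = z"
      by (simp add: z_def B_vec matrix_vector_mult_diff_distrib vec.scale)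
    finally show ?thesis .
  qed
  then have "harmonic_ritz_pair T A K \<sigma> \<theta> v \<longleftrightarrow> v \<noteq> 0 \<and> (\<forall>q\<in>Q. cdot z q = 0)"
    using True by (simp add: harmonic_ritz_pair_def cdot_T_S Q_def)
  moreover have "(\<forall>q\<in>Q. cdot z q = 0) \<longleftrightarrow> P *v z = 0"
    using orth_projector_eq_0[OF subspace_Q, of z] orth_projector_orthogonal[OF subspace_Q, of _ z]
    by (metis cdot_0_right cdot_eq_0_sym)
  moreover have "P *v z = B *v v - (\<theta> - of_real \<sigma>) *s (compression *v (B *v v))"
    using BQ by (simp add: z_def compression_vec HB matrix_vector_mult_diff_distrib vec.scale
        orth_projector(3)[OF subspace_Q])
  ultimately show ?thesis using True by simp
qed (simp add: harmonic_ritz_pair_def)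

text \<open>At \<open>\<theta> = \<sigma>\<close> this is the junk value \<open>1 / 0 = 0\<close>, hence the exclusion of
  \<open>Finite_Ritz \<sigma>\<close> below; its harmonic Ritz space is trivial.\<close>

fun reciprocal_value :: "ritz_value \<Rightarrow> complex"
  where
    "reciprocal_value (Finite_Ritz \<theta>) = 1 / (\<theta> - of_real \<sigma>)"
  | "reciprocal_value Infinite_Ritz = 0"

lemma harmonic_ritz_space_iff:
  assumes "v \<noteq> 0"
  shows "v \<in> harmonic_ritz_space T A K \<sigma> t \<longleftrightarrow> t \<noteq> Finite_Ritz (of_real \<sigma>) \<and> v \<in> K \<and>
    compression *v (B *v v) = reciprocal_value t *s (B *v v)"
proof (cases t)
  case (Finite_Ritz \<theta>)
  define \<xi> where "\<xi> = \<theta> - of_real \<sigma>"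
  have "B *v v \<noteq> 0" using B_inj assms by blast
  \<comment> \<open>For \<open>\<xi> = 0\<close> both sides are false because \<open>B v\<close> is
    nonzero; this is the excluded value \<open>\<theta> = \<sigma>\<close>.\<close>
  then have "B *v v = \<xi> *s g \<longleftrightarrow> \<xi> \<noteq> 0 \<and> g = (1 / \<xi>) *s (B *v v)" for g
    by (cases "\<xi> = 0") auto
  then show ?thesis using assms Finite_Ritz by (auto simp: harmonic_ritz_pair_iff \<xi>_def)
next
  case Infinite_Ritz
  show ?thesis
  proof (cases "v \<in> K")
    case True
    then have BQ: "B *v v \<in> Q" by (rule B_in_Q)
    have "(\<forall>q\<in>Q. cdot (R *v v) q = 0) \<longleftrightarrow> P *v (R *v v) = 0"
      using orth_projector_eq_0[OF subspace_Q, of "R *v v"]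
        orth_projector_orthogonal[OF subspace_Q, of _ "R *v v"]
      by (metis cdot_0_right cdot_eq_0_sym)
    then show ?thesis
      using True BQ Infinite_Ritz by (simp add: cdot_T_S compression_vec HB) (simp add: Q_def)
  qed (use Infinite_Ritz in simp)
qed

text \<open>Values with nontrivial spaces have distinct reciprocals, all of which are eigenvalues of
  the compression on \<open>Q\<close>. Finiteness is what makes \<open>Abs_multiset\<close>
  meaningful.\<close>

lemma finite_nontrivial_ritz_spaces:
  "finite {t. 0 < vec.dim (harmonic_ritz_space T A K \<sigma> t)}" (is "finite ?F")
proof (rule finite_imageD)
  have ex: "\<exists>v. v \<noteq> 0 \<and> v \<in> harmonic_ritz_space T A K \<sigma> t" if "t \<in> ?F" for t
  proof (rule ccontr)
    assume "\<not> ?thesis"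
    then have "harmonic_ritz_space T A K \<sigma> t \<subseteq> {0}" by blast
    then have "vec.dim (harmonic_ritz_space T A K \<sigma> t) = 0" by (simp only: vec.dim_eq_0)
    then show False using that by (simp only: mem_Collect_eq)
  qed
  show "inj_on reciprocal_value ?F"
  proof (rule inj_onI)
    fix s t assume "s \<in> ?F" "t \<in> ?F" and eq: "reciprocal_value s = reciprocal_value t"
    then have "s \<noteq> Finite_Ritz (of_real \<sigma>)" "t \<noteq> Finite_Ritz (of_real \<sigma>)"
      using ex harmonic_ritz_space_iff by blast+
    then show "s = t" using eq by (cases s; cases t) auto
  qed
  obtain E m where E: "orthonormal E"
    "\<And>e. e \<in> E \<Longrightarrow> compression *v e = of_real (m e) *s e"
    "\<And>z. z \<in> Q \<Longrightarrow> (\<Sum>e\<in>E. cdot e z *s e) = z"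
    using hermitian_eigenbasis[OF hermitian_compression subspace_Q compression_in] by blast
  \<comment> \<open>Pairing \<open>B v\<close> with a basis vector to which it is not orthogonal
    identifies the two eigenvalues.\<close>
  have "reciprocal_value t \<in> (\<lambda>e. of_real (m e)) ` E" if t: "t \<in> ?F" for t
  proof -
    obtain v where "v \<noteq> 0" "v \<in> harmonic_ritz_space T A K \<sigma> t" using ex[OF t] by blast
    then have v: "v \<in> K" "compression *v (B *v v) = reciprocal_value t *s (B *v v)" "B *v v \<noteq> 0"
      using harmonic_ritz_space_iff B_inj by blast+
    obtain e where e: "e \<in> E" "cdot e (B *v v) \<noteq> 0"
    proof (rule ccontr)
      assume "\<not> thesis"
      then have "(\<Sum>e\<in>E. cdot e (B *v v) *s e) = 0" using that by (intro sum.neutral) auto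
      then show False using E(3)[OF B_in_Q[OF v(1)]] v(3) by simp
    qed
    have "reciprocal_value t * cdot e (B *v v) = cdot (compression *v e) (B *v v)"
      by (simp add: hermitian_cdot[OF hermitian_compression] v(2) cdot_scale_right)
    also have "\<dots> = of_real (m e) * cdot e (B *v v)"
      by (simp add: E(2)[OF e(1)] cdot_scale_left)
    finally show ?thesis using e by auto
  qed
  then have "reciprocal_value ` ?F \<subseteq> (\<lambda>e. of_real (m e)) ` E" by blast
  then show "finite (reciprocal_value ` ?F)"
    using orthonormal_finite(1)[OF E(1)] by (meson finite_imageI finite_subset)
qed

lemma count_harmonic_ritz_values:
  "count (harmonic_ritz_values T A K \<sigma>) t = vec.dim (harmonic_ritz_space T A K \<sigma> t)"
  unfolding harmonic_ritz_values_def
  by (subst count_Abs_multiset) (use finite_nontrivial_ritz_spaces in auto)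

text \<open>Subtracting the fractions \<open>1 / (\<theta> - \<sigma>)\<close> and
  \<open>1 / (lam - \<sigma>)\<close> produces the gap; the infinite value contributes
  \<open>0\<close>.\<close>

lemma ritz_gap_eq:
  assumes "lam \<noteq> of_real \<sigma>" "t \<noteq> Finite_Ritz (of_real \<sigma>)"
  shows "ritz_gap lam \<sigma> t = cmod (reciprocal_value t - 1 / (lam - of_real \<sigma>))"
proof (cases t)
  case (Finite_Ritz \<theta>)
  then have "\<theta> - of_real \<sigma> \<noteq> 0" "lam - of_real \<sigma> \<noteq> 0" using assms by auto
  then have "reciprocal_value t - 1 / (lam - of_real \<sigma>) =
      - ((\<theta> - lam) / ((lam - of_real \<sigma>) * (\<theta> - of_real \<sigma>)))"
    using Finite_Ritz by (simp add: diff_frac_eq minus_divide_left mult.commute)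
  then show ?thesis using Finite_Ritz by (metis norm_minus_cancel ritz_gap.simps(1))
qed (simp add: norm_divide)

text \<open>Links multiplicities to orthogonality: eigenvalues of the compression on the complement
  of \<open>B v\<close> in \<open>Q\<close> survive the removal of one copy of
  \<open>\<theta>\<close>.\<close>

lemma other_ritz_value:
  assumes v: "harmonic_ritz_pair T A K \<sigma> \<theta> v"
    and z: "z \<in> Q" "z \<noteq> 0" "cdot (B *v v) z = 0" "compression *v z = \<mu> *s z"
  obtains t where "t \<in># harmonic_ritz_values T A K \<sigma> - {#Finite_Ritz \<theta>#}"
    "t \<noteq> Finite_Ritz (of_real \<sigma>)" "reciprocal_value t = \<mu>"
proof -
  obtain u where u: "u \<in> K" "z = B *v u" using z(1) unfolding Q_def by blast
  have "u \<noteq> 0" using u z(2) by auto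
  \<comment> \<open>Solves \<open>reciprocal_value t = \<mu>\<close>.\<close>
  define t where "t = (if \<mu> = 0 then Infinite_Ritz else Finite_Ritz (of_real \<sigma> + 1 / \<mu>))"
  have t: "t \<noteq> Finite_Ritz (of_real \<sigma>)" "reciprocal_value t = \<mu>"
    by (auto simp: t_def)
  have ut: "u \<in> harmonic_ritz_space T A K \<sigma> t"
    using \<open>u \<noteq> 0\<close> t u z by (simp add: harmonic_ritz_space_iff)
  have dim: "card V \<le> vec.dim (harmonic_ritz_space T A K \<sigma> t)"
    if "V \<subseteq> harmonic_ritz_space T A K \<sigma> t" "vec.independent V" for V
    using vec.independent_card_le_dim that by blast
  have ind: "vec.independent {u}" using \<open>u \<noteq> 0\<close> by simp
  have "count {#Finite_Ritz \<theta>#} t < count (harmonic_ritz_values T A K \<sigma>) t"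
  proof (cases "t = Finite_Ritz \<theta>")
    case True
    have "v \<noteq> 0" using v by (simp add: harmonic_ritz_pair_def)
    then have "B *v v \<noteq> 0" using B_inj by blast
    \<comment> \<open>When \<open>t\<close> equals \<open>\<theta>\<close>, independence of
      \<open>v\<close> and \<open>u\<close> gives multiplicity at least two, so a copy
      remains.\<close>
    have "v \<notin> vec.span {u}"
    proof
      assume "v \<in> vec.span {u}"
      then obtain k where "v = k *s u" by (auto simp: vec.span_singleton)
      then have "B *v v = k *s z" using u by (simp add: vec.scale)
      then have "cdot (B *v v) (B *v v) = 0" using z(3) by (simp add: cdot_scale_right)
      then show False using \<open>B *v v \<noteq> 0\<close> by simp
    qed
    moreover from this have "v \<noteq> u" using vec.span_base by blast
    ultimately have "vec.independent {v, u}" "card {v, u} = 2"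
      using ind by (simp_all add: vec.independent_insertI)
    then show ?thesis
      using dim[of "{v, u}"] ut v True by (simp add: count_harmonic_ritz_values)
  next
    case False
    then show ?thesis using dim[of "{u}"] ut ind by (simp add: count_harmonic_ritz_values)
  qed
  then have "t \<in># harmonic_ritz_values T A K \<sigma> - {#Finite_Ritz \<theta>#}"
    by (simp add: in_diff_count)
  then show ?thesis using that t by blast
qed

text \<open>\<open>B x\<close> is an eigenvector of \<open>H\<close> and \<open>B v\<close> a Ritz
  vector for \<open>Q\<close>, so the Rayleigh-Ritz estimate applies.\<close>

lemma harmonic_ritz_vector_bound:
  assumes x: "eigenpair A lam x" and v: "harmonic_ritz_pair T A K \<sigma> \<theta> v"
    and c: "0 \<le> c" "\<And>t. t \<in># harmonic_ritz_values T A K \<sigma> - {#Finite_Ritz \<theta>#} \<Longrightarrow>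
      1 \<le> c * ritz_gap lam \<sigma> t"
    and \<gamma>: "\<And>z. norm (P ** H ** (mat 1 - P) *v z) \<le> \<gamma> * norm z"
  obtains a where
    "norm (B *v (x - a *s v)) \<le> sqrt (1 + (c * \<gamma>)\<^sup>2) * norm (B *v x - P *v (B *v x))"
proof -
  have Ax: "A *v x = lam *s x" and "x \<noteq> 0" using x by (auto simp: eigenpair_def)
  have "lam \<noteq> of_real \<sigma>" using x shift by (auto simp: spectrum_def)
  have lam: "lam = of_real (Re lam)" by (rule hermitian_eigenvalue_real[OF A Ax \<open>x \<noteq> 0\<close>])
  define \<eta> where "\<eta> = 1 / (Re lam - \<sigma>)"
  have eta: "of_real \<eta> = 1 / (lam - of_real \<sigma>)"
    by (subst lam) (simp add: \<eta>_def)
  have "S *v x = (lam - of_real \<sigma>) *s x"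
    unfolding shifted_vec Ax by (simp add: vec.scale_left_diff_distrib)
  then have "B *v x = (lam - of_real \<sigma>) *s (R *v x)"
    by (simp add: B_vec vec.scale matrix_vector_mult_diff_distrib)
  moreover have "of_real \<eta> * (lam - of_real \<sigma>) = 1"
    using \<open>lam \<noteq> of_real \<sigma>\<close> by (simp add: eta)
  ultimately have "of_real \<eta> *s (B *v x) = R *v x"
    by (simp only: vec.scale_scale vec.scale_one)
  then have y: "H *v (B *v x) = of_real \<eta> *s (B *v x)"
    by (simp add: HB)
  define w where "w = B *v v"
  define \<mu> where "\<mu> = 1 / (\<theta> - of_real \<sigma>)"
  have v0: "v \<in> K" "v \<noteq> 0" using v by (auto simp: harmonic_ritz_pair_def)
  have w: "w \<in> Q" "w \<noteq> 0" using v0 B_inj B_in_Q by (auto simp: w_def)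
  have Gw: "compression *v w = \<mu> *s w"
    using harmonic_ritz_space_iff[OF v0(2), of "Finite_Ritz \<theta>"] v by (simp add: w_def \<mu>_def)
  then have PHw: "P *v (H *v w) = \<mu> *s w" by (simp add: compression_vec[OF w(1)])
  define W where "W = {z \<in> Q. cdot w z = 0}"
  have W: "vec.subspace W"
    using subspace_Q unfolding W_def vec.subspace_def by (auto simp: cdot_simps)
  have GW: "compression *v z \<in> W" if "z \<in> W" for z
    using that compression_in hermitian_cdot[OF hermitian_compression, of w z]
    by (auto simp: W_def Gw cdot_simps)
  \<comment> \<open>Eigenvalues on \<open>W\<close> are reciprocals of remaining Ritz values, so
    their distances from \<open>\<eta>\<close> are values of \<open>ritz_gap\<close>.\<close>
  have gap: "1 \<le> c * \<bar>\<nu> - \<eta>\<bar>"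
    if z: "z \<in> W" "z \<noteq> 0" "compression *v z = of_real \<nu> *s z" for \<nu> z
  proof -
    have zW: "z \<in> Q" "cdot (B *v v) z = 0" using z(1) by (auto simp: W_def w_def)
    obtain t where t: "t \<in># harmonic_ritz_values T A K \<sigma> - {#Finite_Ritz \<theta>#}"
      "t \<noteq> Finite_Ritz (of_real \<sigma>)" "reciprocal_value t = of_real \<nu>"
      using other_ritz_value[OF v zW(1) z(2) zW(2) z(3)] by blast
    have "ritz_gap lam \<sigma> t = cmod (of_real (\<nu> - \<eta>))"
      using ritz_gap_eq[OF \<open>lam \<noteq> of_real \<sigma>\<close> t(2)] t(3) eta by simp
    then show ?thesis using c(2)[OF t(1)] by (simp only: norm_of_real)
  qed
  have low: "norm z \<le> c * norm (P *v (H *v z) - of_real \<eta> *s z)" if "z \<in> Q" "cdot w z = 0" for z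
    using norm_le_gap_mult_norm_residual[OF hermitian_compression W GW gap c(1), where z = z] that
    by (simp add: W_def compression_vec)
  obtain a where a: "(norm (B *v x - a *s w))\<^sup>2 \<le>
      (1 + (c * \<gamma>)\<^sup>2) * (norm (B *v x - P *v (B *v x)))\<^sup>2"
    using rayleigh_ritz_vector_bound[OF hermitian_H subspace_Q y w PHw c(1) low \<gamma>] by blast
  have "norm (B *v x - a *s w) \<le> sqrt ((1 + (c * \<gamma>)\<^sup>2) * (norm (B *v x - P *v (B *v x)))\<^sup>2)"
    by (rule real_le_rsqrt[OF a])
  then have "norm (B *v (x - a *s v)) \<le> sqrt (1 + (c * \<gamma>)\<^sup>2) * norm (B *v x - P *v (B *v x))"
    by (simp add: w_def matrix_vector_mult_diff_distrib vec.scale real_sqrt_mult)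
  then show ?thesis using that by blast
qed

end

section \<open>From the estimate in \<open>Q\<close> back to angles in \<open>K\<close>\<close>

theorem theorem5:
  fixes A T :: "complex ^ 'n ^ 'n"
    and x v :: "complex ^ 'n"
    and lam \<theta> :: complex
    and \<sigma> :: real
    and K :: "(complex ^ 'n) set"
    and mnorm :: "complex ^ 'n ^ 'n \<Rightarrow> real"
  assumes "hermitian A"
    and "eigenpair A lam x"
    and "hpd T"
    and "T ** A = A ** T"
    and "vec.subspace K"
    and "complex_of_real \<sigma> \<notin> spectrum A"
    and "harmonic_ritz_pair T A K \<sigma> \<theta> v"
    and "mnorm = spectral_norm \<or> mnorm = frobenius_norm"
  defines "B \<equiv> hpd_sqrt T ** shifted A \<sigma>"
  defines "P \<equiv> orth_projector ((*v) B ` K)"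
  defines "\<gamma> \<equiv> mnorm (P ** matrix_inv (shifted A \<sigma>) ** (mat 1 - P))"
  defines "\<delta> \<equiv> min_gap lam \<sigma> (harmonic_ritz_values T A K \<sigma> - {#Finite_Ritz \<theta>#})"
  assumes "\<delta> \<noteq> 0"
  shows "sin (angle x v)
    \<le> cond_number B * sqrt (1 + real_of_ereal (ereal (\<gamma>\<^sup>2) / \<delta>\<^sup>2)) * sin (angle_subspace x K)"
proof -
  interpret h: harmonic_ritz A T K \<sigma>
    using assms(1,3-6) by unfold_locales
  have B: "h.B = B" by (simp add: h.B_def B_def)
  have P: "orth_projector h.Q = P" by (simp add: h.Q_def B P_def)
  have x0: "x \<noteq> 0" and v0: "v \<in> K" "v \<noteq> 0"
    using assms(2,7) by (auto simp: eigenpair_def harmonic_ritz_pair_def)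
  obtain c where c: "0 \<le> c" "\<And>t. t \<in># harmonic_ritz_values T A K \<sigma> - {#Finite_Ritz \<theta>#} \<Longrightarrow>
      1 \<le> c * ritz_gap lam \<sigma> t"
    and c_eq: "\<And>\<gamma>. real_of_ereal (ereal (\<gamma>\<^sup>2) / \<delta>\<^sup>2) = (c * \<gamma>)\<^sup>2"
    using min_gap_nonzero_cases \<open>\<delta> \<noteq> 0\<close> unfolding \<delta>_def by blast
  have \<gamma>: "norm (P ** matrix_inv (shifted A \<sigma>) ** (mat 1 - P) *v z) \<le> \<gamma> * norm z" for z
    unfolding \<gamma>_def by (rule norm_matrix_vec_le[OF assms(8)])
  define s where "s = sqrt (1 + (c * \<gamma>)\<^sup>2)"
  obtain a where a: "norm (B *v (x - a *s v)) \<le> s * norm (B *v x - P *v (B *v x))"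
    using h.harmonic_ritz_vector_bound[OF assms(2,7) c, unfolded B P, OF _ \<gamma>]
    unfolding s_def by blast
  obtain \<alpha> \<beta> where ab: "\<alpha> > 0" "\<beta> > 0" "cond_number B = \<beta> / \<alpha>"
    "\<And>z. norm (B *v z) \<le> \<beta> * norm z" "\<And>z. \<alpha> * norm z \<le> norm (B *v z)"
    using cond_number_bounds[OF h.hermitian_B h.B_inj] unfolding B by blast
  have "1 \<le> s" by (simp add: s_def)
  have pos: "0 < cond_number B * s" using ab \<open>1 \<le> s\<close> by simp
  have bound: "sin (angle x v) \<le> cond_number B * s * sin (angle x y)" if y: "y \<in> K" "y \<noteq> 0" for y
  proof -
    \<comment> \<open>The point of the line of \<open>y\<close> nearest to \<open>x\<close>.\<close>
    define k where "k = (cdot y x / of_real ((norm y)\<^sup>2)) *s y"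
    have "k \<in> K" unfolding k_def using y assms(5) by (intro vec.subspace_scale)
    have "\<alpha> * (norm x * sin (angle x v)) \<le> \<alpha> * norm (x - a *s v)"
      using norm_mult_sin_angle_le[OF x0 v0(2)] ab(1) by simp
    also have "\<dots> \<le> norm (B *v (x - a *s v))" by (rule ab(5))
    also have "\<dots> \<le> s * norm (B *v x - P *v (B *v x))" by (rule a)
    also have "\<dots> \<le> s * norm (B *v x - B *v k)"
      using norm_orth_projector_residual_le[OF h.subspace_Q h.B_in_Q[OF \<open>k \<in> K\<close>], of "B *v x"]
        \<open>1 \<le> s\<close>
      unfolding P B by (intro mult_left_mono) auto
    also have "\<dots> \<le> s * (\<beta> * norm (x - k))"
      using ab(4)[of "x - k"] \<open>1 \<le> s\<close>
      by (intro mult_left_mono) (simp_all add: matrix_vector_mult_diff_distrib)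
    also have "norm (x - k) = norm x * sin (angle x y)"
      unfolding k_def by (rule norm_mult_sin_angle[OF x0 y(2), symmetric])
    finally have "norm x * (\<alpha> * sin (angle x v)) \<le> norm x * (s * \<beta> * sin (angle x y))"
      by (simp add: mult_ac)
    then have "\<alpha> * sin (angle x v) \<le> s * \<beta> * sin (angle x y)"
      using x0 by simp
    also have "\<dots> = \<alpha> * (cond_number B * s * sin (angle x y))" using ab(1,3) by simp
    finally show ?thesis using ab(1) by simp
  qed
  \<comment> \<open>Dividing by the positive factor gives a lower bound uniform in \<open>y\<close>,
    which passes to the angle with \<open>K\<close>.\<close>
  have "sin (angle x v) / (cond_number B * s) \<le> sin (angle_subspace x K)"
  proof (rule le_sin_angle_subspace[OF v0])
    have "0 \<le> sin (angle x v)"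
      using angle_bounds[of x v] pi_gt_zero by (intro sin_ge_zero) linarith+
    then show "0 \<le> sin (angle x v) / (cond_number B * s)" using pos by simp
    show "sin (angle x v) / (cond_number B * s) \<le> sin (angle x y)" if "y \<in> K" "y \<noteq> 0" for y
      using bound[OF that] pos by (simp add: pos_divide_le_eq mult_ac)
  qed
  then show ?thesis
    unfolding c_eq s_def[symmetric] using pos by (simp add: pos_divide_le_eq mult_ac)
qed

end
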